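(* Let $\triangle ABC$ be a right triangle with $\angle C=\pi/2$ and rational side lengths $BC=a$, $CA=b$, $AB=c$ ($c$ the hypotenuse). Let $r_a,r_b,r_c$ denote the radii of the excircles tangent to $BC$, $CA$, $AB$ respectively. (a) If $r_a=1$, then $(a,b,c)=(x+1,\,z-1,\,z-x)$ for some rational point $(x,z)$ on the curve $X_a:\ z-zx-x=1$. (b) If $r_b=1$, then $(a,b,c)=(z-1,\,x+1,\,z-x)$ for some rational point $(x,z)$ on the curve $X_b:\ z(x-1)+x+1=0$. (c) If $r_c=1$, then $(a,b,c)=(1-y,\,1-x,\,x+y)$ for some rational point $(x,y)$ on the curve $X_c:\ xy+x+y=1$. Each of the curves $X_a,X_b,X_c$ is a rational curve of genus zero. Consequently, for each $\ell\in\{a,b,c\}$ there exist infinitely many rational right triangles with $r_\ell=1$.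
   Context: The excircle of a triangle opposite a vertex is the circle tangent to the opposite side and to the extensions of the other two sides; $r_a$ is the radius of the excircle tangent to side $BC$ (length $a$), and similarly $r_b$, $r_c$. A rational right triangle is a right triangle with all side lengths rational. *)

theory Defs
  imports
    "HOL-Algebra.Algebraic_Closure_Type"
    "HOL-Algebra.Embedded_Algebras"
    "HOL-Algebra.QuotRing"
    "HOL-Computational_Algebra.Computational_Algebra"
    "HOL-Analysis.Analysis"
begin

section \<open>Triangles and excircles\<close>

definition vertex_angle :: "real^2 \<Rightarrow> real^2 \<Rightarrow> real^2 \<Rightarrow> real" where
  "vertex_angle P Q R = arccos (((P - Q) \<bullet> (R - Q)) / (norm (P - Q) * norm (R - Q)))"

definition right_triangle :: "real^2 \<Rightarrow> real^2 \<Rightarrow> real^2 \<Rightarrow> bool" where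
  "right_triangle A B C \<longleftrightarrow> \<not> collinear {A, B, C} \<and> vertex_angle A C B = pi / 2"

definition rational_right_triangle ::
  "real^2 \<Rightarrow> real^2 \<Rightarrow> real^2 \<Rightarrow> rat \<Rightarrow> rat \<Rightarrow> rat \<Rightarrow> bool" where
  "rational_right_triangle A B C a b c \<longleftrightarrow>
     right_triangle A B C \<and>
     dist B C = real_of_rat a \<and> dist C A = real_of_rat b \<and> dist A B = real_of_rat c"

definition tangent_at :: "real^2 \<Rightarrow> real \<Rightarrow> real^2 \<Rightarrow> real^2 \<Rightarrow> real^2 \<Rightarrow> bool" where
  "tangent_at M r P Q T \<longleftrightarrow> sphere M r \<inter> affine hull {P, Q} = {T}"

text \<open>The excircle of \<open>A B C\<close> opposite its first vertex \<open>A\<close>. It touches the line \<open>B C\<close> in a point of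
  the side, and the lines \<open>A B\<close> and \<open>A C\<close> in points outside the sides.\<close>

definition is_excircle :: "real^2 \<Rightarrow> real^2 \<Rightarrow> real^2 \<Rightarrow> real^2 \<Rightarrow> real \<Rightarrow> bool" where
  "is_excircle A B C M r \<longleftrightarrow> r > 0 \<and>
     (\<exists>T \<in> closed_segment B C. tangent_at M r B C T) \<and>
     (\<exists>T \<in> affine hull {A, B} - closed_segment A B. tangent_at M r A B T) \<and>
     (\<exists>T \<in> affine hull {A, C} - closed_segment A C. tangent_at M r A C T)"

definition is_exradius :: "real^2 \<Rightarrow> real^2 \<Rightarrow> real^2 \<Rightarrow> real \<Rightarrow> bool" where
  "is_exradius A B C r \<longleftrightarrow> (\<exists>M. is_excircle A B C M r)"


section \<open>The genus of a function field\<close>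

text \<open>For a function field \<open>F\<close> in one variable with a subfield \<open>k\<close> of constants, a place is represented
  by its normalised discrete valuation, which is trivial on \<open>k\<close>. Valuations are made \<open>extensional\<close>
  so that distinct functions are distinct places; \<open>v 0 = \<infinity>\<close> is replaced by case distinctions.\<close>

definition places :: "('a, 'm) ring_scheme \<Rightarrow> 'a set \<Rightarrow> ('a \<Rightarrow> int) set" where
  "places F k = {v \<in> extensional (carrier F - {\<zero>\<^bsub>F\<^esub>}).
     v ` (carrier F - {\<zero>\<^bsub>F\<^esub>}) = UNIV \<and>
     (\<forall>x \<in> carrier F - {\<zero>\<^bsub>F\<^esub>}. \<forall>y \<in> carrier F - {\<zero>\<^bsub>F\<^esub>}. v (x \<otimes>\<^bsub>F\<^esub> y) = v x + v y) \<and>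
     (\<forall>x \<in> carrier F - {\<zero>\<^bsub>F\<^esub>}. \<forall>y \<in> carrier F - {\<zero>\<^bsub>F\<^esub>}.
        x \<oplus>\<^bsub>F\<^esub> y \<noteq> \<zero>\<^bsub>F\<^esub> \<longrightarrow> min (v x) (v y) \<le> v (x \<oplus>\<^bsub>F\<^esub> y)) \<and>
     (\<forall>c \<in> k - {\<zero>\<^bsub>F\<^esub>}. v c = 0)}"

definition place_ring :: "('a, 'm) ring_scheme \<Rightarrow> ('a \<Rightarrow> int) \<Rightarrow> ('a, 'm) ring_scheme" where
  "place_ring F v = F\<lparr>carrier := {x \<in> carrier F. x = \<zero>\<^bsub>F\<^esub> \<or> 0 \<le> v x}\<rparr>"

definition place_ideal :: "('a, 'm) ring_scheme \<Rightarrow> ('a \<Rightarrow> int) \<Rightarrow> 'a set" where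
  "place_ideal F v = {x \<in> carrier F. x = \<zero>\<^bsub>F\<^esub> \<or> 0 < v x}"

definition residue_field :: "('a, 'm) ring_scheme \<Rightarrow> ('a \<Rightarrow> int) \<Rightarrow> 'a set ring" where
  "residue_field F v = place_ring F v Quot place_ideal F v"

text \<open>The degree of the residue field over the image of \<open>k\<close>.\<close>

definition place_degree :: "('a, 'm) ring_scheme \<Rightarrow> 'a set \<Rightarrow> ('a \<Rightarrow> int) \<Rightarrow> nat" where
  "place_degree F k v =
     ring.dim (residue_field F v)
       ((\<lambda>c. place_ideal F v +>\<^bsub>place_ring F v\<^esub> c) ` k) (carrier (residue_field F v))"

definition divisors :: "('a, 'm) ring_scheme \<Rightarrow> 'a set \<Rightarrow> (('a \<Rightarrow> int) \<Rightarrow> int) set" where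
  "divisors F k = {D. finite {v \<in> places F k. D v \<noteq> 0}}"

definition divisor_degree :: "('a, 'm) ring_scheme \<Rightarrow> 'a set \<Rightarrow> (('a \<Rightarrow> int) \<Rightarrow> int) \<Rightarrow> int" where
  "divisor_degree F k D =
     (\<Sum>v \<in> {v \<in> places F k. D v \<noteq> 0}. D v * int (place_degree F k v))"

definition riemann_roch_space :: "('a, 'm) ring_scheme \<Rightarrow> 'a set \<Rightarrow> (('a \<Rightarrow> int) \<Rightarrow> int) \<Rightarrow> 'a set"
  where
  "riemann_roch_space F k D =
     {x \<in> carrier F. x = \<zero>\<^bsub>F\<^esub> \<or> (\<forall>v \<in> places F k. - D v \<le> v x)}"

text \<open>The genus is the maximum of \<open>deg D - l(D) + 1\<close> over all divisors \<open>D\<close> (Riemann's theorem says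
  that it exists).\<close>

definition function_field_has_genus :: "('a, 'm) ring_scheme \<Rightarrow> 'a set \<Rightarrow> nat \<Rightarrow> bool" where
  "function_field_has_genus F k g \<longleftrightarrow>
     (\<exists>D \<in> divisors F k.
        divisor_degree F k D - int (ring.dim F k (riemann_roch_space F k D)) + 1 = int g) \<and>
     (\<forall>D \<in> divisors F k.
        divisor_degree F k D - int (ring.dim F k (riemann_roch_space F k D)) + 1 \<le> int g)"


section \<open>Plane curves over the rationals\<close>

text \<open>A bivariate polynomial is a polynomial in the second coordinate \<open>Y\<close> whose coefficients are
  polynomials in the first coordinate \<open>X\<close>.\<close>

abbreviation coord_X :: "rat poly poly" where "coord_X \<equiv> [:[:0, 1:]:]"
abbreviation coord_Y :: "rat poly poly" where "coord_Y \<equiv> [:0, 1:]"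

definition rational_points :: "rat poly poly \<Rightarrow> (rat \<times> rat) set" where
  "rational_points f = {(x, y). poly (poly f [:y:]) x = 0}"

text \<open>The field of rational functions on an irreducible curve \<open>f = 0\<close>: the ring of those fractions
  \<open>p / q\<close> whose denominator does not vanish identically on the curve, modulo the ideal of those whose
  numerator does.\<close>

definition curve_local_ring :: "rat poly poly \<Rightarrow> rat poly poly fract ring" where
  "curve_local_ring f =
     (ring_of_type_algebra :: rat poly poly fract ring)\<lparr>carrier := {Fract p q | p q. \<not> f dvd q}\<rparr>"

definition curve_ideal :: "rat poly poly \<Rightarrow> rat poly poly fract set" where
  "curve_ideal f = {Fract p q | p q. f dvd p \<and> \<not> f dvd q}"

definition curve_function_field :: "rat poly poly \<Rightarrow> rat poly poly fract set ring" where
  "curve_function_field f = curve_local_ring f Quot curve_ideal f"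

definition curve_const :: "rat poly poly \<Rightarrow> rat \<Rightarrow> rat poly poly fract set" where
  "curve_const f c = curve_ideal f +>\<^bsub>curve_local_ring f\<^esub> Fract [:[:c:]:] 1"

text \<open>A curve is rational (over the rationals) if it is birational to the line, that is, if its
  function field is isomorphic over the rationals to the field \<open>rat poly fract\<close> of rational
  functions in one variable.\<close>

definition rational_curve :: "rat poly poly \<Rightarrow> bool" where
  "rational_curve f \<longleftrightarrow> Factorial_Ring.irreducible f \<and>
     (\<exists>h \<in> ring_iso (curve_function_field f) (ring_of_type_algebra :: rat poly fract ring).
        \<forall>c. h (curve_const f c) = Fract [:c:] 1)"

text \<open>The geometric genus of an irreducible plane curve, i.e. that of its smooth projective model.\<close>

definition has_genus :: "rat poly poly \<Rightarrow> nat \<Rightarrow> bool" where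
  "has_genus f g \<longleftrightarrow> Factorial_Ring.irreducible f \<and>
     function_field_has_genus (curve_function_field f) (range (curve_const f)) g"

definition curve_Xa :: "rat poly poly" where
  "curve_Xa = coord_Y - coord_Y * coord_X - coord_X - 1"

definition curve_Xb :: "rat poly poly" where
  "curve_Xb = coord_Y * (coord_X - 1) + coord_X + 1"

definition curve_Xc :: "rat poly poly" where
  "curve_Xc = coord_X * coord_Y + coord_X + coord_Y - 1"

lemma rational_points_Xa: "(x, z) \<in> rational_points curve_Xa \<longleftrightarrow> z - z * x - x = 1"
  by (auto simp: rational_points_def curve_Xa_def algebra_simps)

lemma rational_points_Xb: "(x, z) \<in> rational_points curve_Xb \<longleftrightarrow> z * (x - 1) + x + 1 = 0"
  by (auto simp: rational_points_def curve_Xb_def algebra_simps)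

lemma rational_points_Xc: "(x, y) \<in> rational_points curve_Xc \<longleftrightarrow> x * y + x + y = 1"
  by (auto simp: rational_points_def curve_Xc_def algebra_simps)

end

theory Submission
  imports Defs
begin

text \<open>In coordinates along the legs, a circle of radius \<open>r\<close> touching all three side lines has centre
  \<open>(\<plusminus>r, \<plusminus>r)\<close>; tangency to the hypotenuse leaves one value of \<open>r\<close> for each of the four tritangent
  circles, and the positions of the tangency points single out the excircles, with
  \<open>2 r\<^sub>a = c + a - b\<close>, \<open>2 r\<^sub>b = c + b - a\<close> and \<open>2 r\<^sub>c = a + b + c\<close>. Together with Pythagoras
  this gives the curves.

  Each curve is \<open>u(x) y + w(x) = 0\<close> with \<open>u\<close>, \<open>w\<close> coprime, so substituting \<open>y = - w / u\<close> identifies its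
  function field with the rational functions in one variable. There the places are the \<open>P\<close>-adic
  valuations and the order at infinity, of degrees \<open>deg P\<close> and 1; the finite part of a divisor \<open>D\<close> is
  principal, so its Riemann--Roch space is a multiple of the space of polynomials of degree at most
  \<open>deg D\<close>, and \<open>deg D - l(D) + 1\<close> is at most 0, with equality at \<open>D = 0\<close>.\<close>

section \<open>Tritangent circles of a right triangle\<close>

text \<open>The genus is a maximum over all divisors, so exhibiting a few of them proves nothing:
  every place of the function field has to be known together with its degree, and every Riemann-Roch
  space has to be measured. An Ostrowski-type classification supplies the places. All dimensions
  then come from a single count, that of the polynomials of degree below \<open>n\<close> under an
  injective map that is linear over the constants; it serves the residue fields at the primes and at
  infinity as well as the Riemann-Roch spaces.

  In the geometric half, tangency means having a single common point, which is first turned into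
  orthogonality of radius and line. The resulting equations are quadratic and lose signs; these are
  recovered from the positivity of \<open>r\<close> and from the location of the tangency points.
  For the infinite families the curves alone do not suffice, since a rational point may give a
  negative side: the parameter is confined to an interval where all three sides are positive, and
  the excircle is constructed there.\<close>

lemma tangent_atD:
  assumes "tangent_at M r P Q T"
  shows "T \<in> affine hull {P, Q}" "dist M T = r" "(M - T) \<bullet> (Q - P) = 0"
proof -
  have eq: "sphere M r \<inter> affine hull {P, Q} = {T}"
    using assms by (simp add: tangent_at_def)
  then show T: "T \<in> affine hull {P, Q}" and r: "dist M T = r" by auto
  show "(M - T) \<bullet> (Q - P) = 0"
  proof (rule ccontr)
    define d where "d = Q - P"
    assume "\<not> ?thesis"
    then have nz: "(M - T) \<bullet> d \<noteq> 0" "d \<bullet> d \<noteq> 0" by (auto simp: d_def)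
    \<comment> \<open>With this \<open>s\<close>, the point \<open>T + s *\<^sub>R d\<close> is the
      mirror image of \<open>T\<close> in the foot of the perpendicular from \<open>M\<close>. It
      lies on the line and on the circle, and differs from \<open>T\<close> unless
      \<open>M - T\<close> is orthogonal to \<open>d\<close>.\<close>
    define s where "s = 2 * ((M - T) \<bullet> d) / (d \<bullet> d)"
    have "T + s *\<^sub>R d \<in> affine hull {P, Q}"
    proof -
      obtain u v where "T = u *\<^sub>R P + v *\<^sub>R Q" "u + v = 1"
        using T by (auto simp: affine_hull_2)
      then have "T + s *\<^sub>R d = (u - s) *\<^sub>R P + (v + s) *\<^sub>R Q" "(u - s) + (v + s) = 1"
        by (auto simp: d_def algebra_simps)
      then show ?thesis unfolding affine_hull_2 by blast
    qed
    moreover have "dist M (T + s *\<^sub>R d) = r"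
    proof -
      have "s * (d \<bullet> d) = 2 * ((M - T) \<bullet> d)" using nz by (simp add: s_def)
      then have "s * (s * (d \<bullet> d)) = s * (2 * ((M - T) \<bullet> d))" by simp
      moreover have "(M - (T + s *\<^sub>R d)) \<bullet> (M - (T + s *\<^sub>R d))
          = (M - T) \<bullet> (M - T) - s * (2 * ((M - T) \<bullet> d)) + s * (s * (d \<bullet> d))"
        by (simp add: inner_simps inner_commute algebra_simps)
      ultimately have "(M - (T + s *\<^sub>R d)) \<bullet> (M - (T + s *\<^sub>R d)) = (M - T) \<bullet> (M - T)" by simp
      then show ?thesis using r by (simp add: dist_norm norm_eq_sqrt_inner)
    qed
    ultimately have "T + s *\<^sub>R d \<in> sphere M r \<inter> affine hull {P, Q}" by simp
    then have "s *\<^sub>R d = 0" unfolding eq by simp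
    then show False using nz by (auto simp: s_def)
  qed
qed

lemma line_param:
  fixes P Q :: "real^2"
  assumes "T \<in> affine hull {P, Q}"
  obtains t where "T = P + t *\<^sub>R (Q - P)"
proof -
  obtain u v where "T = u *\<^sub>R P + v *\<^sub>R Q" "u + v = 1"
    using assms by (auto simp: affine_hull_2)
  then have "T = (1 - v) *\<^sub>R P + v *\<^sub>R Q" by (simp add: eq_diff_eq flip: \<open>u + v = 1\<close>)
  then have "T = P + v *\<^sub>R (Q - P)" by (simp add: algebra_simps)
  then show thesis by (rule that)
qed

text \<open>By Pythagoras at \<open>T\<close>, every other point of the line is farther from
  \<open>M\<close> than \<open>T\<close> is.\<close>

lemma tangent_atI:
  fixes P Q :: "real^2"
  assumes T: "T \<in> affine hull {P, Q}" and "dist M T = r" and orth: "(M - T) \<bullet> (Q - P) = 0"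
  shows "tangent_at M r P Q T"
proof -
  have "x = T" if x: "x \<in> sphere M r \<inter> affine hull {P, Q}" for x :: "real^2"
  proof -
    obtain u where u: "T = P + u *\<^sub>R (Q - P)" using T by (rule line_param)
    obtain v where v: "x = P + v *\<^sub>R (Q - P)" using x line_param[of x P Q] by blast
    have "x - T = (v - u) *\<^sub>R (Q - P)" unfolding u v by (simp add: algebra_simps)
    then have "(M - T) \<bullet> (x - T) = 0" using orth by simp
    moreover have "(M - x) \<bullet> (M - x) = (M - T) \<bullet> (M - T) - 2 * ((M - T) \<bullet> (x - T)) + (x - T) \<bullet> (x - T)"
      by (simp add: inner_simps inner_commute algebra_simps)
    moreover have "(M - x) \<bullet> (M - x) = (M - T) \<bullet> (M - T)"
      using assms(2) that by (auto simp: dist_norm simp flip: power2_norm_eq_inner)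
    ultimately show "x = T" by simp
  qed
  moreover have "T \<in> sphere M r \<inter> affine hull {P, Q}" using assms by simp
  ultimately show ?thesis unfolding tangent_at_def by blast
qed

lemma param_in_line: "P + t *\<^sub>R (Q - P) \<in> affine hull {P, Q}" for P Q :: "real^2"
proof -
  have "P + t *\<^sub>R (Q - P) = (1 - t) *\<^sub>R P + t *\<^sub>R Q" by (simp add: algebra_simps)
  then show ?thesis unfolding affine_hull_2 by (intro CollectI exI[of _ "1 - t"] exI[of _ t]) auto
qed

lemma param_in_segment_iff:
  fixes P Q :: "real^2"
  assumes "P \<noteq> Q"
  shows "P + t *\<^sub>R (Q - P) \<in> closed_segment P Q \<longleftrightarrow> 0 \<le> t \<and> t \<le> 1"
proof -
  have "P + t *\<^sub>R (Q - P) = (1 - u) *\<^sub>R P + u *\<^sub>R Q \<longleftrightarrow> t = u" for u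
  proof -
    have "P + t *\<^sub>R (Q - P) = (1 - u) *\<^sub>R P + u *\<^sub>R Q \<longleftrightarrow> (t - u) *\<^sub>R (Q - P) = 0"
      by (auto simp: algebra_simps)
    then show ?thesis using assms by simp
  qed
  then show ?thesis by (auto simp: in_segment)
qed

text \<open>In the plane, \<open>f\<close> must be the quarter turn of \<open>e\<close> up to the
  sign \<open>\<delta>\<close>, the determinant of the pair. Once
  \<open>\<delta> * \<delta> = 1\<close> is known, the sum of products is
  \<open>e \<bullet> e\<close> times \<open>x \<bullet> y\<close>.\<close>

lemma inner_orthonormal:
  fixes e f x y :: "real^2"
  assumes "e \<bullet> e = 1" "f \<bullet> f = 1" "e \<bullet> f = 0"
  shows "x \<bullet> y = (x \<bullet> e) * (y \<bullet> e) + (x \<bullet> f) * (y \<bullet> f)"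
proof -
  define e1 e2 f1 f2 x1 x2 y1 y2 where vs: "e1 = vec_nth e 1" "e2 = vec_nth e 2" "f1 = vec_nth f 1" "f2 = vec_nth f 2"
    "x1 = vec_nth x 1" "x2 = vec_nth x 2" "y1 = vec_nth y 1" "y2 = vec_nth y 2"
  define \<delta> where "\<delta> = e1 * f2 - e2 * f1"
  have 1: "e1 * e1 + e2 * e2 = 1" "f1 * f1 + f2 * f2 = 1" "e1 * f1 + e2 * f2 = 0"
    using assms by (auto simp: inner_vec_def sum_2 vs)
  have f1_eq: "f1 = - \<delta> * e2"
  proof -
    have "f1 + \<delta> * e2 = e1 * (e1 * f1 + e2 * f2) + f1 * (1 - (e1 * e1 + e2 * e2))"
      unfolding \<delta>_def by (simp add: algebra_simps)
    then show ?thesis using 1 by simp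
  qed
  have f2_eq: "f2 = \<delta> * e1"
  proof -
    have "f2 - \<delta> * e1 = e2 * (e1 * f1 + e2 * f2) + f2 * (1 - (e1 * e1 + e2 * e2))"
      unfolding \<delta>_def by (simp add: algebra_simps)
    then show ?thesis using 1 by simp
  qed
  have "\<delta> * \<delta> * (e1 * e1 + e2 * e2) = f1 * f1 + f2 * f2"
    unfolding f1_eq f2_eq by (simp add: algebra_simps)
  then have \<delta>: "\<delta> * \<delta> = 1" using 1 by simp
  have "(x \<bullet> e) * (y \<bullet> e) + (x \<bullet> f) * (y \<bullet> f) =
    (x1 * e1 + x2 * e2) * (y1 * e1 + y2 * e2) +
    (\<delta> * \<delta>) * ((x2 * e1 - x1 * e2) * (y2 * e1 - y1 * e2))"
    unfolding inner_vec_def sum_2 vs[symmetric] f1_eq f2_eq by (simp add: algebra_simps)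
  also have "\<dots> = (e1 * e1 + e2 * e2) * (x1 * y1 + x2 * y2)"
    unfolding \<delta> by (simp add: algebra_simps)
  finally show ?thesis using 1 by (simp add: inner_vec_def sum_2 vs)
qed

lemma right_triangleD:
  assumes "right_triangle A B C"
  shows "(A - C) \<bullet> (B - C) = 0" "A \<noteq> C" "B \<noteq> C" "A \<noteq> B"
proof -
  have nc: "\<not> collinear {A, B, C}" and ang: "vertex_angle A C B = pi / 2"
    using assms by (auto simp: right_triangle_def)
  show ne: "A \<noteq> C" "B \<noteq> C" "A \<noteq> B" using nc by (auto simp: insert_commute)
  define x where "x = ((A - C) \<bullet> (B - C)) / (norm (A - C) * norm (B - C))"
  \<comment> \<open>\<open>cos\<close> undoes \<open>arccos\<close> only on the interval from -1 to
    1, which Cauchy-Schwarz guarantees here.\<close>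
  have "\<bar>x\<bar> \<le> 1"
    using Cauchy_Schwarz_ineq2[of "A - C" "B - C"] ne by (simp add: x_def abs_divide divide_le_eq)
  moreover have "arccos x = pi / 2" using ang by (simp add: vertex_angle_def x_def)
  ultimately have "x = 0" by (metis abs_le_iff cos_arccos cos_pi_half minus_le_iff)
  then show "(A - C) \<bullet> (B - C) = 0" using ne by (simp add: x_def)
qed

lemma right_triangleI:
  assumes "(A - C) \<bullet> (B - C) = 0" "A \<noteq> C" "B \<noteq> C"
  shows "right_triangle A B C"
proof -
  have "\<not> collinear {A, B, C}"
  proof
    assume "collinear {A, B, C}"
    then have "collinear {A, C, B}" by (simp add: insert_commute)
    then have "collinear {0, A - C, B - C}" by (auto simp: collinear_def)
    then obtain t where "B - C = t *\<^sub>R (A - C)"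
      using assms(2,3) unfolding collinear_lemma by (metis right_minus_eq)
    then show False using assms by auto
  qed
  then show ?thesis using assms by (simp add: right_triangle_def vertex_angle_def)
qed

lemma is_exradius_commute: "is_exradius A B C r \<longleftrightarrow> is_exradius A C B r"
proof -
  have "tangent_at M r B C T = tangent_at M r C B T" for M T
    by (simp add: tangent_at_def insert_commute)
  then show ?thesis
    by (auto simp: is_exradius_def is_excircle_def closed_segment_commute)
qed

section \<open>Tangency in coordinates along the legs\<close>

lemma inner_right_angle:
  fixes x y u v :: "real^2"
  assumes "u \<bullet> v = 0" "u \<noteq> 0" "v \<noteq> 0"
  shows "x \<bullet> y = (x \<bullet> u / norm u) * (y \<bullet> u / norm u) + (x \<bullet> v / norm v) * (y \<bullet> v / norm v)"
  using inner_orthonormal[of "u /\<^sub>R norm u" "v /\<^sub>R norm v" x y] assms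
  by (simp add: divide_inverse mult_ac flip: power2_norm_eq_inner power2_eq_square)

text \<open>\<open>T\<close> is the foot of the perpendicular from \<open>M\<close>. Hence
  \<open>M\<close> and \<open>T\<close> have the same coordinate along \<open>P Q\<close>, which
  decides whether \<open>T\<close> is on the side, while the coordinate of \<open>M\<close> along
  the other leg is the signed distance to the line \<open>P Q\<close>.\<close>

lemma tangent_leg:
  fixes P Q R M :: "real^2"
  assumes right: "(Q - P) \<bullet> (R - P) = 0" and ne: "Q \<noteq> P" "R \<noteq> P"
    and tan: "tangent_at M r P Q T"
  shows "((M - P) \<bullet> (R - P) / dist P R)\<^sup>2 = r\<^sup>2"
    and "T \<in> closed_segment P Q \<longleftrightarrow>
      0 \<le> (M - P) \<bullet> (Q - P) / dist P Q \<and> (M - P) \<bullet> (Q - P) / dist P Q \<le> dist P Q"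
proof -
  obtain t where T: "T = P + t *\<^sub>R (Q - P)"
    using tangent_atD(1)[OF tan] by (rule line_param)
  have n: "norm (Q - P) > 0" "dist P Q = norm (Q - P)" "dist P R = norm (R - P)"
    using ne by (auto simp: dist_norm norm_minus_commute)
  have "(M - T) \<bullet> (Q - P) = (M - P) \<bullet> (Q - P) - t * (norm (Q - P))\<^sup>2"
    by (simp add: T inner_diff_left inner_add_left power2_norm_eq_inner)
  with tangent_atD(3)[OF tan] have p: "(M - P) \<bullet> (Q - P) = t * (norm (Q - P))\<^sup>2" by simp
  have "(M - T) \<bullet> (R - P) = (M - P) \<bullet> (R - P)"
    using right by (simp add: T inner_diff_left inner_add_left)
  then have "(M - T) \<bullet> (M - T) = ((M - P) \<bullet> (R - P) / norm (R - P))\<^sup>2"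
    using inner_right_angle[of "Q - P" "R - P" "M - T" "M - T"] right ne tangent_atD(3)[OF tan]
    by (simp add: power2_eq_square)
  then show "((M - P) \<bullet> (R - P) / dist P R)\<^sup>2 = r\<^sup>2"
    using tangent_atD(2)[OF tan] unfolding n(3) by (simp add: dist_norm power2_norm_eq_inner flip: power2_norm_eq_inner)
  show "T \<in> closed_segment P Q \<longleftrightarrow>
      0 \<le> (M - P) \<bullet> (Q - P) / dist P Q \<and> (M - P) \<bullet> (Q - P) / dist P Q \<le> dist P Q"
    using n(1) ne unfolding n T p by (simp add: param_in_segment_iff power2_eq_square zero_le_mult_iff)
qed

lemma pythagoras:
  fixes A B C :: "'a :: real_inner"
  assumes "(A - C) \<bullet> (B - C) = 0"
  shows "(dist A B)\<^sup>2 = (dist C B)\<^sup>2 + (dist C A)\<^sup>2"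
proof -
  have "(norm ((A - C) - (B - C)))\<^sup>2 = (norm (A - C))\<^sup>2 + (norm (B - C))\<^sup>2"
    using assms norm_minus_cancel[of "B - C"]
      norm_add_Pythagorean[of "A - C" "- (B - C)"] by (simp add: orthogonal_def inner_diff_right norm_minus_commute)
  then show ?thesis by (simp add: dist_norm norm_minus_commute)
qed

text \<open>With the legs as axes, of lengths \<open>a\<close> and \<open>b\<close>, the hypotenuse
  has the equation \<open>b * x + a * y = a * b\<close>; the claim is the formula for the distance
  of \<open>(p, q)\<close> from that line, squared and cleared of denominators.\<close>

lemma tangent_hypotenuse:
  fixes A B C M :: "real^2"
  assumes right: "(A - C) \<bullet> (B - C) = 0" and ne: "A \<noteq> C" "B \<noteq> C"
    and tan: "tangent_at M r A B T"
  defines "p \<equiv> (M - C) \<bullet> (B - C) / dist C B" and "q \<equiv> (M - C) \<bullet> (A - C) / dist C A"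
  shows "(dist C A * p + dist C B * q - dist C B * dist C A)\<^sup>2 = r\<^sup>2 * (dist A B)\<^sup>2"
proof -
  define e f where "e = (B - C) /\<^sub>R norm (B - C)" and "f = (A - C) /\<^sub>R norm (A - C)"
  define a b where "a = norm (B - C)" and "b = norm (A - C)"
  have n: "a > 0" "b > 0" "dist C B = a" "dist C A = b"
    using ne by (auto simp: dist_norm norm_minus_commute a_def b_def)
  obtain t where T: "T = A + t *\<^sub>R (B - A)"
    using tangent_atD(1)[OF tan] by (rule line_param)
  have on: "e \<bullet> e = 1" "f \<bullet> f = 1" "e \<bullet> f = 0"
    using ne right by (auto simp: e_def f_def inner_commute[of "B - C"] simp flip: power2_norm_eq_inner)
  have Be: "(B - C) = a *\<^sub>R e" and Af: "(A - C) = b *\<^sub>R f"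
    using n by (auto simp: e_def f_def a_def b_def)
  have BA: "B - A = a *\<^sub>R e - b *\<^sub>R f" unfolding Be[symmetric] Af[symmetric] by simp
  have p: "p = (M - C) \<bullet> e" and q: "q = (M - C) \<bullet> f"
    using n by (simp_all add: p_def q_def Be Af)
  define x y where "x = (M - T) \<bullet> e" and "y = (M - T) \<bullet> f"
  have MT: "M - T = (M - C) - b *\<^sub>R f - t *\<^sub>R (a *\<^sub>R e - b *\<^sub>R f)"
    unfolding BA[symmetric] unfolding Af[symmetric] T by simp
  have x: "x = p - t * a"
    unfolding x_def MT p using on by (simp add: inner_diff_left inner_commute[of f e])
  have y: "y = q - b + t * b"
    unfolding y_def MT q using on by (simp add: inner_diff_left algebra_simps)
  have eq0: "a * x = b * y"
    using tangent_atD(3)[OF tan] by (simp add: BA x_def y_def inner_diff_right)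
  have "r\<^sup>2 = x\<^sup>2 + y\<^sup>2"
    using tangent_atD(2)[OF tan] inner_orthonormal[OF on, of "M - T" "M - T"]
    by (auto simp: x_def y_def dist_norm power2_norm_eq_inner power2_eq_square[of "_ \<bullet> _"])
  moreover have "(dist A B)\<^sup>2 = a\<^sup>2 + b\<^sup>2"
    using pythagoras[OF right] by (simp add: n)
  moreover have "b * p + a * q - a * b = b * x + a * y" unfolding x y by (simp add: algebra_simps)
  \<comment> \<open>Lagrange's identity; the subtracted square vanishes because \<open>M - T\<close>
    is orthogonal to the hypotenuse.\<close>
  moreover have "(b * x + a * y)\<^sup>2 = (x\<^sup>2 + y\<^sup>2) * (a\<^sup>2 + b\<^sup>2) - (a * x - b * y)\<^sup>2"
    by (simp add: power2_eq_square algebra_simps)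
  ultimately show ?thesis using eq0 n by simp
qed

section \<open>The four tritangent radii\<close>

context
  fixes a b c :: real
  assumes pos: "0 < a" "0 < b" "0 < c" and pyth: "c\<^sup>2 = a\<^sup>2 + b\<^sup>2"
begin

lemma hypotenuse_bounds: "a < c" "b < c" "c < a + b"
proof -
  have "a\<^sup>2 < c\<^sup>2" "b\<^sup>2 < c\<^sup>2" using pos pyth by auto
  then show "a < c" "b < c" using pos by (meson less_imp_le power2_less_imp_less)+
  have "c\<^sup>2 < (a + b)\<^sup>2" using pos pyth by (simp add: power2_sum)
  then show "c < a + b" using pos by (meson add_pos_pos less_imp_le power2_less_imp_less)
qed

text \<open>Differences of squares: the products are \<open>c^2 - (a - b)^2\<close> and
  \<open>(a + b)^2 - c^2\<close>.\<close>

lemma cross_product: "(c + b - a) * (c + a - b) = 2 * (a * b)" "(a + b + c) * (a + b - c) = 2 * (a * b)"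
  using pyth by (simp_all add: algebra_simps power2_eq_square)

text \<open>Since \<open>a * b\<close> is twice the area, the four premises are the area formulas
  for the three excircles and the incircle. Only for a right triangle do they become linear: by
  \<open>cross_product\<close>, dividing \<open>a * b\<close> by one factor leaves half of the
  complementary one.\<close>

lemma tritangent_radius:
  assumes "0 < r"
  shows "r * (c + b - a) = a * b \<Longrightarrow> 2 * r = c + a - b"
    and "r * (c + a - b) = a * b \<Longrightarrow> 2 * r = c + b - a"
    and "r * (a + b - c) = a * b \<Longrightarrow> 2 * r = a + b + c"
    and "r * (a + b + c) = a * b \<Longrightarrow> 2 * r = a + b - c"
proof -
  have *: "2 * r = v" if "r * u = a * b" "u * v = 2 * (a * b)" "u > 0" for u v
  proof -
    have "u * (2 * r) = u * v" using that by (simp add: mult.commute)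
    then show ?thesis using that(3) by (simp only: mult_cancel_left) simp
  qed
  show "2 * r = c + a - b" if "r * (c + b - a) = a * b"
    using that cross_product(1) by (rule *) (use hypotenuse_bounds pos in linarith)
  show "2 * r = c + b - a" if "r * (c + a - b) = a * b"
    using that cross_product(1)[unfolded mult.commute[of "c + b - a"]]
    by (rule *) (use hypotenuse_bounds pos in linarith)
  show "2 * r = a + b + c" if "r * (a + b - c) = a * b"
    using that cross_product(2)[unfolded mult.commute[of "a + b + c"]]
    by (rule *) (use hypotenuse_bounds pos in linarith)
  show "2 * r = a + b - c" if "r * (a + b + c) = a * b"
    using that cross_product(2) by (rule *) (use hypotenuse_bounds pos in linarith)
qed

text \<open>There are eight sign patterns for \<open>p\<close>, \<open>q\<close> and the side of the
  hypotenuse. Four of them equate a positive quantity with a negative one. The survivors are, in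
  order, the excircle opposite the right angle, the incircle, and the excircles opposite the
  endpoints of the hypotenuse.\<close>

lemma tritangent_center_cases:
  assumes r: "0 < r" "p\<^sup>2 = r\<^sup>2" "q\<^sup>2 = r\<^sup>2" "(b * p + a * q - a * b)\<^sup>2 = r\<^sup>2 * c\<^sup>2"
  obtains "p = r" "q = r" "2 * r = a + b + c" | "p = r" "q = r" "2 * r = a + b - c"
    | "p = r" "q = - r" "2 * r = c + a - b" | "p = - r" "q = r" "2 * r = c + b - a"
proof -
  have p: "p = r \<or> p = - r" and q: "q = r \<or> q = - r" using r by (auto simp: power2_eq_iff)
  have "(b * p + a * q - a * b)\<^sup>2 = (r * c)\<^sup>2" using r by (simp add: power_mult_distrib)
  then have e: "b * p + a * q - a * b = r * c \<or> b * p + a * q - a * b = - (r * c)"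
    by (auto simp: power2_eq_iff)
  have P: "0 < a * b" "0 < r * (c + b - a)" "0 < r * (c + a - b)" "0 < r * (a + b - c)" "0 < r * (a + b + c)"
    using pos r(1) hypotenuse_bounds by auto
  note T = tritangent_radius[OF r(1)]
  show thesis
  proof (cases "p = r"; cases "q = r")
    assume [simp]: "p = r" "q = r"
    have "r * (a + b - c) = a * b \<or> r * (a + b + c) = a * b" using e by (auto simp: algebra_simps)
    then show thesis using T that by auto
  next
    assume [simp]: "p = r" and "q \<noteq> r"
    then have [simp]: "q = - r" using q by auto
    have "r * (c + a - b) = - (a * b) \<or> r * (c + b - a) = a * b" using e by (auto simp: algebra_simps)
    then show thesis using P T that by auto
  next
    assume "p \<noteq> r" and [simp]: "q = r"
    then have [simp]: "p = - r" using p by auto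
    have "r * (c + b - a) = - (a * b) \<or> r * (c + a - b) = a * b" using e by (auto simp: algebra_simps)
    then show thesis using P T that by auto
  next
    assume "p \<noteq> r" "q \<noteq> r"
    then have [simp]: "p = - r" "q = - r" using p q by auto
    have "r * (a + b + c) = - (a * b) \<or> r * (a + b - c) = - (a * b)" using e by (auto simp: algebra_simps)
    then show thesis using P by auto
  qed
qed

end

text \<open>The tangency points on the two legs tell the four circles apart. The incircle touches
  both legs inside, the excircle opposite the right angle touches both outside, and each of the
  other two touches inside exactly the leg opposite its vertex; the strict triangle inequalities
  place the centre coordinates accordingly.\<close>

lemma
  assumes tri: "right_triangle A B C"
  shows exradius_leg: "is_exradius A B C r \<Longrightarrow> 2 * r = dist A B + dist B C - dist C A"
    and exradius_hypotenuse: "is_exradius C A B r \<Longrightarrow> 2 * r = dist B C + dist C A + dist A B"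
proof -
  note R = right_triangleD[OF tri]
  then have R': "(B - C) \<bullet> (A - C) = 0" by (simp add: inner_commute)
  have pos: "0 < dist C B" "0 < dist C A" "0 < dist A B" using R by auto
  note bounds = hypotenuse_bounds[OF pos pythagoras[OF R(1)]]
  note center = tritangent_center_cases[OF pos pythagoras[OF R(1)]]
  note leg = tangent_leg[OF R' R(3,2)] and leg' = tangent_leg[OF R(1) R(2,3)]
  note hyp = tangent_hypotenuse[OF R(1-3)]
  have com: "tangent_at M r B C T = tangent_at M r C B T" "tangent_at M r A C T = tangent_at M r C A T"
    "closed_segment B C = closed_segment C B" "closed_segment A C = closed_segment C A" for M r T
    by (auto simp: tangent_at_def insert_commute closed_segment_commute)
  show "2 * r = dist A B + dist B C - dist C A" if "is_exradius A B C r"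
  proof -
    obtain M T1 T2 T3 where M: "r > 0" "T1 \<in> closed_segment C B" "tangent_at M r C B T1"
      "tangent_at M r A B T2" "T3 \<notin> closed_segment C A" "tangent_at M r C A T3"
      using \<open>is_exradius A B C r\<close> unfolding is_exradius_def is_excircle_def com by blast
    show ?thesis
      using M(2,5) leg(2)[OF M(3)] leg'(2)[OF M(6)] bounds
      by (cases rule: center[OF M(1) leg'(1)[OF M(6)] leg(1)[OF M(3)] hyp[OF M(4)]])
        (auto simp: dist_commute)
  qed
  show "2 * r = dist B C + dist C A + dist A B" if "is_exradius C A B r"
  proof -
    obtain M T1 T2 T3 where M: "r > 0" "T1 \<notin> closed_segment C B" "tangent_at M r C B T1"
      "tangent_at M r A B T2" "T3 \<notin> closed_segment C A" "tangent_at M r C A T3"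
      using \<open>is_exradius C A B r\<close> unfolding is_exradius_def is_excircle_def com by blast
    show ?thesis
      using M(1,2,5) leg(2)[OF M(3)] leg'(2)[OF M(6)] bounds
      by (cases rule: center[OF M(1) leg'(1)[OF M(6)] leg(1)[OF M(3)] hyp[OF M(4)]])
        (auto simp: dist_commute)
  qed
qed

section \<open>Construction of the excircles\<close>

lemma is_excircleI:
  fixes A B C M :: "real^2"
  assumes "0 < r" "A \<noteq> B" "A \<noteq> C" "B \<noteq> C" "0 \<le> t" "t \<le> 1" "1 < t'" "1 < t''"
    and T: "T = B + t *\<^sub>R (C - B)" "T' = A + t' *\<^sub>R (B - A)" "T'' = A + t'' *\<^sub>R (C - A)"
    and "dist M T = r" "dist M T' = r" "dist M T'' = r"
    and "(M - T) \<bullet> (C - B) = 0" "(M - T') \<bullet> (B - A) = 0" "(M - T'') \<bullet> (C - A) = 0"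
  shows "is_excircle A B C M r"
proof -
  have "T \<in> closed_segment B C" "T' \<notin> closed_segment A B" "T'' \<notin> closed_segment A C"
    unfolding T using assms by (simp_all add: param_in_segment_iff)
  moreover have "T \<in> affine hull {B, C}" "T' \<in> affine hull {A, B}" "T'' \<in> affine hull {A, C}"
    unfolding T by (rule param_in_line)+
  ultimately show ?thesis
    using assms tangent_atI unfolding is_excircle_def by blast
qed

lemma vector_2_simps:
  fixes a b c d :: real
  shows "vector [a, b] + vector [c, d] = (vector [a + c, b + d] :: real^2)"
    "vector [a, b] - vector [c, d] = (vector [a - c, b - d] :: real^2)"
    "c *\<^sub>R vector [a, b] = (vector [c * a, c * b] :: real^2)"
    "vector [a, b] \<bullet> (vector [c, d] :: real^2) = a * c + b * d"
    "dist (vector [a, b]) (vector [c, d] :: real^2) = sqrt ((a - c)\<^sup>2 + (b - d)\<^sup>2)"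
    "(vector [a, b] :: real^2) = vector [c, d] \<longleftrightarrow> a = c \<and> b = d"
  by (simp_all add: vec_eq_iff forall_2 inner_vec_def sum_2 dist_vec_def L2_set_def dist_real_def)

context
  fixes a b c :: real and A B C :: "real^2"
  assumes pos: "0 < a" "0 < b" "0 < c" and pyth: "c\<^sup>2 = a\<^sup>2 + b\<^sup>2"
  defines "A \<equiv> vector [0, b]" and "B \<equiv> vector [a, 0]" and "C \<equiv> vector [0, 0]"
begin

lemma right_triangle_coordinates:
  "right_triangle A B C" "dist B C = a" "dist C A = b" "dist A B = c"
proof -
  show "right_triangle A B C"
    using pos by (intro right_triangleI) (simp_all add: A_def B_def C_def vector_2_simps)
  show "dist B C = a" "dist C A = b" "dist A B = c"
    using pos by (simp_all add: A_def B_def C_def vector_2_simps pyth[symmetric] add.commute)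
qed

lemma exradius_leg_exists: "is_exradius A B C ((c + a - b) / 2)"
proof -
  \<comment> \<open>Both tangents from \<open>A\<close> to this circle have the semiperimeter
    \<open>s\<close> as their length. So \<open>\<sigma> = s / c\<close> locates the tangency point
    on the line \<open>A B\<close>, and on the line \<open>A C\<close> it lies at distance
    \<open>b + r = s\<close> from \<open>A\<close>.\<close>
  define r s where "r = (c + a - b) / 2" and "s = (a + b + c) / 2"
  define \<sigma> where "\<sigma> = s / c"
  note bounds = hypotenuse_bounds[OF pos pyth]
  have s: "s = r + b" "s = \<sigma> * c" using pos by (auto simp: r_def s_def \<sigma>_def)
  \<comment> \<open>For the centre \<open>M\<close> at \<open>(r, - r)\<close> this says
    \<open>(M - A) \<bullet> (B - A) = s * c\<close>: the foot of the perpendicular from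
    \<open>M\<close> to \<open>A B\<close> is at distance \<open>s\<close> from
    \<open>A\<close>.\<close>
  have 1: "a * r + b * s = s * c"
    using pyth by (simp add: r_def s_def power2_eq_square algebra_simps)
  have "\<sigma> * (c\<^sup>2) = s * c" using s by (simp add: power2_eq_square)
  then have orth: "(r - \<sigma> * a) * a - (\<sigma> * b - s) * b = 0"
    using 1 unfolding pyth by (simp add: power2_eq_square algebra_simps)
  have "(r - \<sigma> * a)\<^sup>2 + (\<sigma> * b - s)\<^sup>2 = r\<^sup>2 + s\<^sup>2 + \<sigma>\<^sup>2 * c\<^sup>2 - 2 * \<sigma> * (a * r + b * s)"
    unfolding pyth by (simp add: power2_eq_square algebra_simps)
  also have "\<dots> = r\<^sup>2 + s\<^sup>2 + (\<sigma> * c)\<^sup>2 - 2 * s * (\<sigma> * c)"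
    unfolding 1 by (simp add: power_mult_distrib)
  also have "\<dots> = r\<^sup>2" unfolding s(2)[symmetric] by (simp add: power2_eq_square)
  finally have norm: "(r - \<sigma> * a)\<^sup>2 + (\<sigma> * b - s)\<^sup>2 = r\<^sup>2" .
  have r: "0 < r" "r \<le> a" "c < s" using bounds pos by (auto simp: r_def s_def)
  have "is_excircle A B C (vector [r, -r]) r"
  proof (rule is_excircleI)
    show "vector [r, 0] = B + (1 - r / a) *\<^sub>R (C - B)"
      "vector [\<sigma> * a, b - \<sigma> * b] = A + \<sigma> *\<^sub>R (B - A)"
      "vector [0, -r] = A + (1 + r / b) *\<^sub>R (C - A)"
      using pos by (simp_all add: A_def B_def C_def vector_2_simps field_simps)
    show "1 < \<sigma>" using r pos by (simp add: \<sigma>_def)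
    have e: "- r - (b - \<sigma> * b) = \<sigma> * b - s" using s by simp
    show "dist (vector [r, - r]) (vector [\<sigma> * a, b - \<sigma> * b] :: real^2) = r"
      "(vector [r, - r] - vector [\<sigma> * a, b - \<sigma> * b]) \<bullet> (B - A) = 0"
      using orth r by (simp_all only: A_def B_def vector_2_simps e norm) simp_all
  qed (use r pos in \<open>simp_all add: A_def B_def C_def vector_2_simps\<close>)
  then show ?thesis unfolding is_exradius_def r_def by blast
qed

lemma exradius_hypotenuse_exists: "is_exradius C A B ((a + b + c) / 2)"
proof -
  define s where "s = (a + b + c) / 2"
  \<comment> \<open>The tangent from \<open>A\<close> to the excircle opposite \<open>C\<close> has
    length \<open>s - b\<close>, and the tangents from \<open>C\<close> have length
    \<open>s\<close>, which is also the radius because the angle at \<open>C\<close> is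
    right.\<close>
  define \<tau> where "\<tau> = (s - b) / c"
  note bounds = hypotenuse_bounds[OF pos pyth]
  have \<tau>: "s - b = \<tau> * c" using pos by (auto simp: s_def \<tau>_def)
  have 1: "s * (b + c - a) = b * (b + c)"
    using pyth by (simp add: s_def power2_eq_square algebra_simps)
  have 2: "\<tau> * c\<^sup>2 = (s - b) * c" using \<tau> by (simp add: power2_eq_square)
  then have orth: "(s - \<tau> * a) * a - (s - b + \<tau> * b) * b = 0"
    using 1 unfolding pyth by (simp add: power2_eq_square algebra_simps)
  have "(s - \<tau> * a)\<^sup>2 + (s - b + \<tau> * b)\<^sup>2 = s\<^sup>2 + (s - b)\<^sup>2 + \<tau> * (\<tau> * c\<^sup>2) + 2 * \<tau> * (b * (s - b) - a * s)"
    unfolding pyth by (simp add: power2_eq_square algebra_simps)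
  also have "\<dots> = s\<^sup>2 + (s - b) * (\<tau> * c) + \<tau> * ((s - b) * c) + 2 * \<tau> * (b * (s - b) - a * s)"
    unfolding 2 \<tau>[symmetric] by (simp add: power2_eq_square)
  also have "\<dots> = s\<^sup>2 + 2 * \<tau> * (s * (b + c - a) - b * (b + c))"
    by (simp add: algebra_simps)
  finally have norm: "(s - \<tau> * a)\<^sup>2 + (s - b + \<tau> * b)\<^sup>2 = s\<^sup>2" using 1 by simp
  have s: "0 < s" "a < s" "b < s" "s \<le> b + c" using bounds pos by (auto simp: s_def)
  have "is_excircle C A B (vector [s, s]) s"
  proof (rule is_excircleI)
    show "vector [\<tau> * a, b - \<tau> * b] = A + \<tau> *\<^sub>R (B - A)"
      "vector [0, s] = C + (s / b) *\<^sub>R (A - C)" "vector [s, 0] = C + (s / a) *\<^sub>R (B - C)"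
      using pos by (simp_all add: A_def B_def C_def vector_2_simps field_simps)
    show "0 \<le> \<tau>" "\<tau> \<le> 1" using s pos by (auto simp: \<tau>_def)
    have e: "s - (b - \<tau> * b) = s - b + \<tau> * b" by simp
    show "dist (vector [s, s]) (vector [\<tau> * a, b - \<tau> * b] :: real^2) = s"
      "(vector [s, s] - vector [\<tau> * a, b - \<tau> * b]) \<bullet> (B - A) = 0"
      using orth s by (simp_all only: A_def B_def vector_2_simps e norm) simp_all
  qed (use s pos in \<open>simp_all add: A_def B_def C_def vector_2_simps\<close>)
  then show ?thesis unfolding is_exradius_def s_def by blast
qed

end

section \<open>Rational right triangles with an exradius equal to one\<close>

lemma rational_right_triangleD:
  assumes "rational_right_triangle A B C a b c"
  shows "c\<^sup>2 = a\<^sup>2 + b\<^sup>2"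
    and "is_exradius A B C 1 \<Longrightarrow> c = b - a + 2"
    and "is_exradius B C A 1 \<Longrightarrow> c = a - b + 2"
    and "is_exradius C A B 1 \<Longrightarrow> c = 2 - a - b"
proof -
  have tri: "right_triangle A B C" and d: "dist B C = real_of_rat a" "dist C A = real_of_rat b"
    "dist A B = real_of_rat c" using assms by (auto simp: rational_right_triangle_def)
  have "(dist A B)\<^sup>2 = (dist B C)\<^sup>2 + (dist C A)\<^sup>2"
    using pythagoras[OF right_triangleD(1)[OF tri]] by (simp add: dist_commute)
  then have "real_of_rat (c\<^sup>2) = real_of_rat (a\<^sup>2 + b\<^sup>2)" unfolding d by (simp add: of_rat_add of_rat_power)
  then show "c\<^sup>2 = a\<^sup>2 + b\<^sup>2" by (simp only: of_rat_eq_iff)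
  \<comment> \<open>Exchanging the names of the two acute vertices turns the formula for the
    excircle opposite \<open>A\<close> into the one opposite \<open>B\<close>.\<close>
  have "right_triangle B A C"
    using right_triangleD[OF tri] by (intro right_triangleI) (auto simp: inner_commute)
  from exradius_leg[OF this, of 1] have b: "2 = dist A B + dist C A - dist B C" if "is_exradius B C A 1"
    using that by (simp add: is_exradius_commute[of B C A] dist_commute)
  note a = exradius_leg[OF tri, of 1] and c = exradius_hypotenuse[OF tri, of 1]
  show "c = b - a + 2" if "is_exradius A B C 1"
  proof -
    have "real_of_rat c = real_of_rat (b - a + 2)" using a[OF that] by (simp add: d of_rat_add of_rat_diff)
    then show ?thesis by (simp only: of_rat_eq_iff)
  qed
  show "c = a - b + 2" if "is_exradius B C A 1"
  proof -
    have "real_of_rat c = real_of_rat (a - b + 2)" using b[OF that] by (simp add: d of_rat_add of_rat_diff)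
    then show ?thesis by (simp only: of_rat_eq_iff)
  qed
  show "c = 2 - a - b" if "is_exradius C A B 1"
  proof -
    have "real_of_rat c = real_of_rat (2 - a - b)" using c[OF that] by (simp add: d of_rat_add of_rat_diff)
    then show ?thesis by (simp only: of_rat_eq_iff)
  qed
qed

lemma rational_right_triangle_exists:
  fixes a b c :: rat
  assumes "0 < a" "0 < b" "0 < c" and pyth: "c\<^sup>2 = a\<^sup>2 + b\<^sup>2"
  obtains A B C where "rational_right_triangle A B C a b c"
    and "c + a - b = 2 \<Longrightarrow> is_exradius A B C 1" and "a + b + c = 2 \<Longrightarrow> is_exradius C A B 1"
proof -
  have pos: "0 < real_of_rat a" "0 < real_of_rat b" "0 < real_of_rat c" using assms by simp_all
  have "real_of_rat (c\<^sup>2) = real_of_rat (a\<^sup>2 + b\<^sup>2)" using pyth by (simp only:)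
  then have pyth': "(real_of_rat c)\<^sup>2 = (real_of_rat a)\<^sup>2 + (real_of_rat b)\<^sup>2"
    by (simp add: of_rat_add of_rat_power)
  have "(real_of_rat c + real_of_rat a - real_of_rat b) / 2 = 1" if "c + a - b = 2"
    using arg_cong[OF that, of real_of_rat] by (simp add: of_rat_add of_rat_diff)
  moreover have "(real_of_rat a + real_of_rat b + real_of_rat c) / 2 = 1" if "a + b + c = 2"
    using arg_cong[OF that, of real_of_rat] by (simp add: of_rat_add of_rat_diff)
  ultimately show thesis
    using that right_triangle_coordinates[OF pos pyth'] exradius_leg_exists[OF pos pyth']
      exradius_hypotenuse_exists[OF pos pyth'] unfolding rational_right_triangle_def
    by metis
qed

lemma rational_right_triangle_swap:
  assumes "rational_right_triangle A B C a b c"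
  shows "rational_right_triangle B A C b a c"
  using assms right_triangleD[of A B C] unfolding rational_right_triangle_def
  by (auto intro!: right_triangleI simp: dist_commute inner_commute)

lemma infinite_exradius_leg:
  "infinite {(a, b, c). \<exists>A B C. rational_right_triangle A B C a b c \<and> is_exradius A B C 1}"
proof -
  \<comment> \<open>The curve \<open>X_a\<close> solved for \<open>x\<close> gives
    \<open>x = (z - 1) / (z + 1)\<close>; \<open>f\<close> is \<open>(x + 1, z - 1, z - x)\<close>
    at this point. The bound \<open>1 < z\<close> makes the sides positive, and the second entry
    makes \<open>f\<close> injective.\<close>
  define f :: "rat \<Rightarrow> rat \<times> rat \<times> rat" where
    "f z = (2 * z / (z + 1), z - 1, (z\<^sup>2 + 1) / (z + 1))" for z
  have "f ` {1<..} \<subseteq> {(a, b, c). \<exists>A B C. rational_right_triangle A B C a b c \<and> is_exradius A B C 1}"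
  proof (rule image_subsetI)
    fix z :: rat assume "z \<in> {1<..}"
    then have z: "1 < z" "z + 1 \<noteq> 0" by auto
    have "((z\<^sup>2 + 1) / (z + 1))\<^sup>2 = (2 * z / (z + 1))\<^sup>2 + (z - 1)\<^sup>2"
    proof -
      have "(z\<^sup>2 + 1)\<^sup>2 = (2 * z)\<^sup>2 + ((z - 1) * (z + 1))\<^sup>2"
        by (simp add: power2_eq_square algebra_simps)
      moreover have "z - 1 = (z - 1) * (z + 1) / (z + 1)" using z by simp
      ultimately show ?thesis by (metis add_divide_distrib power_divide)
    qed
    moreover have "(z\<^sup>2 + 1) / (z + 1) + 2 * z / (z + 1) - (z - 1) = 2"
    proof -
      have "(z\<^sup>2 + 1) / (z + 1) + 2 * z / (z + 1) = (z + 1) * (z + 1) / (z + 1)"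
        unfolding add_divide_distrib[symmetric] by (simp add: power2_eq_square algebra_simps)
      then show ?thesis using z by simp
    qed
    moreover have "0 < 2 * z / (z + 1)" "0 < z - 1" "0 < (z\<^sup>2 + 1) / (z + 1)"
      using z by (auto intro!: divide_pos_pos add_nonneg_pos)
    ultimately show "f z \<in> {(a, b, c). \<exists>A B C. rational_right_triangle A B C a b c \<and> is_exradius A B C 1}"
      unfolding f_def using rational_right_triangle_exists by (simp, metis)
  qed
  moreover have "infinite (f ` {1<..})"
    by (subst finite_image_iff) (auto simp: inj_on_def f_def infinite_Ioi)
  ultimately show ?thesis using finite_subset by blast
qed

lemma infinite_exradius_other_leg:
  "infinite {(a, b, c). \<exists>A B C. rational_right_triangle A B C a b c \<and> is_exradius B C A 1}"
proof -
  have "{(a, b, c). \<exists>A B C. rational_right_triangle A B C a b c \<and> is_exradius A B C 1} \<subseteq>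
    (\<lambda>(a, b, c). (b, a, c)) `
      {(a, b, c). \<exists>A B C. rational_right_triangle A B C a b c \<and> is_exradius B C A 1}"
  proof safe
    fix a b c A B C assume "rational_right_triangle A B C a b c" "is_exradius A B C 1"
    then have "rational_right_triangle B A C b a c" "is_exradius A C B 1"
      using rational_right_triangle_swap is_exradius_commute by blast+
    then show "(a, b, c) \<in> (\<lambda>(a, b, c). (b, a, c)) `
        {(a, b, c). \<exists>A B C. rational_right_triangle A B C a b c \<and> is_exradius B C A 1}"
      by (intro image_eqI[of _ _ "(b, a, c)"]) auto
  qed
  then show ?thesis using infinite_exradius_leg finite_surj by blast
qed

lemma infinite_exradius_hypotenuse:
  "infinite {(a, b, c). \<exists>A B C. rational_right_triangle A B C a b c \<and> is_exradius C A B 1}"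
proof -
  \<comment> \<open>Here \<open>X_c\<close> is solved for \<open>y = (1 - x) / (1 + x)\<close> and
    inserted in \<open>(1 - y, 1 - x, x + y)\<close>; all sides are positive for \<open>x\<close>
    strictly between 0 and 1.\<close>
  define f :: "rat \<Rightarrow> rat \<times> rat \<times> rat" where
    "f x = (2 * x / (1 + x), 1 - x, (1 + x\<^sup>2) / (1 + x))" for x
  have "f ` {0<..<1} \<subseteq> {(a, b, c). \<exists>A B C. rational_right_triangle A B C a b c \<and> is_exradius C A B 1}"
  proof (rule image_subsetI)
    fix x :: rat assume "x \<in> {0<..<1}"
    then have x: "0 < x" "x < 1" "1 + x \<noteq> 0" by auto
    have "((1 + x\<^sup>2) / (1 + x))\<^sup>2 = (2 * x / (1 + x))\<^sup>2 + (1 - x)\<^sup>2"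
    proof -
      have "(1 + x\<^sup>2)\<^sup>2 = (2 * x)\<^sup>2 + ((1 - x) * (1 + x))\<^sup>2"
        by (simp add: power2_eq_square algebra_simps)
      moreover have "1 - x = (1 - x) * (1 + x) / (1 + x)" using x by simp
      ultimately show ?thesis by (metis add_divide_distrib power_divide)
    qed
    moreover have "2 * x / (1 + x) + (1 - x) + (1 + x\<^sup>2) / (1 + x) = 2"
    proof -
      have "2 * x / (1 + x) + (1 + x\<^sup>2) / (1 + x) = (1 + x) * (1 + x) / (1 + x)"
        unfolding add_divide_distrib[symmetric] by (simp add: power2_eq_square algebra_simps)
      then show ?thesis using x by simp
    qed
    moreover have "0 < 2 * x / (1 + x)" "0 < 1 - x" "0 < (1 + x\<^sup>2) / (1 + x)"
      using x by (auto intro!: divide_pos_pos add_pos_nonneg)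
    ultimately show "f x \<in> {(a, b, c). \<exists>A B C. rational_right_triangle A B C a b c \<and> is_exradius C A B 1}"
      unfolding f_def using rational_right_triangle_exists by (simp, metis)
  qed
  moreover have "infinite (f ` {0<..<1})"
    by (subst finite_image_iff) (auto simp: inj_on_def f_def)
  ultimately show ?thesis using finite_subset by blast
qed

text \<open>Each radius condition makes \<open>c\<close> an affine function of \<open>a\<close> and
  \<open>b\<close>. Substituted in Pythagoras, it cancels the squares and leaves the equation of the
  curve; the witnesses are read off the first two sides.\<close>

lemma exradius_points:
  assumes "rational_right_triangle A B C a b c"
  shows "is_exradius A B C 1 \<Longrightarrow>
      \<exists>x z. (x, z) \<in> rational_points curve_Xa \<and> (a, b, c) = (x + 1, z - 1, z - x)"
    and "is_exradius B C A 1 \<Longrightarrow>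
      \<exists>x z. (x, z) \<in> rational_points curve_Xb \<and> (a, b, c) = (z - 1, x + 1, z - x)"
    and "is_exradius C A B 1 \<Longrightarrow>
      \<exists>x y. (x, y) \<in> rational_points curve_Xc \<and> (a, b, c) = (1 - y, 1 - x, x + y)"
proof -
  note D = rational_right_triangleD[OF assms]
  show "\<exists>x z. (x, z) \<in> rational_points curve_Xa \<and> (a, b, c) = (x + 1, z - 1, z - x)"
    if "is_exradius A B C 1"
    using D(1) D(2)[OF that]
    by (intro exI[of _ "a - 1"] exI[of _ "b + 1"])
      (simp add: rational_points_Xa power2_eq_square algebra_simps)
  show "\<exists>x z. (x, z) \<in> rational_points curve_Xb \<and> (a, b, c) = (z - 1, x + 1, z - x)"
    if "is_exradius B C A 1"
    using D(1) D(3)[OF that]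
    by (intro exI[of _ "b - 1"] exI[of _ "a + 1"])
      (simp add: rational_points_Xb power2_eq_square algebra_simps)
  show "\<exists>x y. (x, y) \<in> rational_points curve_Xc \<and> (a, b, c) = (1 - y, 1 - x, x + y)"
    if "is_exradius C A B 1"
    using D(1) D(4)[OF that]
    by (intro exI[of _ "1 - b"] exI[of _ "1 - a"])
      (simp add: rational_points_Xc power2_eq_square algebra_simps)
qed

section \<open>Function fields of curves of degree one in the second coordinate\<close>

lemma ring_of_type_algebra_simps [simp]:
  "carrier ring_of_type_algebra = UNIV"
  "x \<otimes>\<^bsub>ring_of_type_algebra\<^esub> y = x * y" "x \<oplus>\<^bsub>ring_of_type_algebra\<^esub> y = x + y"
  "\<one>\<^bsub>ring_of_type_algebra\<^esub> = 1" "\<zero>\<^bsub>ring_of_type_algebra\<^esub> = 0"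
  by (simp_all add: ring_of_type_algebra_def)

lemma a_inv_ring_of_type_algebra [simp]:
  "\<ominus>\<^bsub>ring_of_type_algebra\<^esub> x = - (x :: 'a :: comm_ring_1)"
proof -
  interpret ring "ring_of_type_algebra :: 'a ring" by (rule ring_from_type_algebra)
  show ?thesis by (rule minus_equality) simp_all
qed

context
  fixes w u :: "rat poly" and f :: "rat poly poly"
  assumes u: "u \<noteq> 0" and cop: "coprime w u"
  defines "f \<equiv> [:w, u:]"
begin

lemma irreducible_linear_curve: "Factorial_Ring.irreducible f"
  unfolding f_def using u cop by (rule irreducible_linear_poly)

lemma prime_linear_curve: "prime_elem f"
  unfolding f_def using u cop by (rule prime_elem_linear_poly)

definition eval_curve :: "rat poly poly \<Rightarrow> rat poly fract" where
  "eval_curve p = poly (fract_poly p) (- to_fract w / to_fract u)"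

lemma eval_curve_hom:
  "eval_curve (p + q) = eval_curve p + eval_curve q" "eval_curve (p * q) = eval_curve p * eval_curve q"
  "eval_curve 1 = 1" "eval_curve [:c:] = to_fract c"
  by (simp_all add: eval_curve_def map_poly_pCons)

text \<open>Over the field of fractions, \<open>f\<close> is a unit times \<open>Y - y\<close>, so
  vanishing at \<open>y\<close> means divisibility there. As \<open>f\<close> has content 1, Gauss's
  lemma brings the divisibility back to polynomial coefficients.\<close>

lemma eval_curve_eq_0_iff: "eval_curve p = 0 \<longleftrightarrow> f dvd p"
proof -
  define y where "y = - to_fract w / to_fract u"
  have "fract_poly f = smult (to_fract u) [:- y, 1:]"
    using u by (simp add: f_def y_def map_poly_pCons)
  then have "fract_poly f dvd fract_poly p \<longleftrightarrow> [:- y, 1:] dvd fract_poly p"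
    using u by (simp only: smult_dvd_iff) simp
  then have "eval_curve p = 0 \<longleftrightarrow> fract_poly f dvd fract_poly p"
    by (simp only: eval_curve_def poly_eq_0_iff_dvd y_def)
  moreover have "Polynomial.content f = 1"
    using irreducible_linear_curve nonconst_poly_irreducible_iff[of f] u by (simp add: f_def)
  ultimately show ?thesis using fract_poly_dvd fract_poly_dvdD by blast
qed

definition eval_fract :: "rat poly poly fract \<Rightarrow> rat poly fract" where
  "eval_fract x = (SOME z. \<exists>p q. x = Fract p q \<and> \<not> f dvd q \<and> z = eval_curve p / eval_curve q)"

lemma eval_fract_Fract:
  assumes "\<not> f dvd q"
  shows "eval_fract (Fract p q) = eval_curve p / eval_curve q"
  unfolding eval_fract_def
proof (rule some_equality)
  show "\<exists>p' q'. Fract p q = Fract p' q' \<and> \<not> f dvd q' \<and>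
    eval_curve p / eval_curve q = eval_curve p' / eval_curve q'" using assms by blast
next
  fix z assume "\<exists>p' q'. Fract p q = Fract p' q' \<and> \<not> f dvd q' \<and> z = eval_curve p' / eval_curve q'"
  then obtain p' q' where eq: "Fract p q = Fract p' q'" and q': "\<not> f dvd q'"
    and z: "z = eval_curve p' / eval_curve q'" by blast
  have "q \<noteq> 0" "q' \<noteq> 0" using assms q' by auto
  then have "p * q' = p' * q" using eq by (simp add: eq_fract)
  then have "eval_curve p * eval_curve q' = eval_curve p' * eval_curve q"
    by (metis eval_curve_hom(2))
  moreover have "eval_curve q \<noteq> 0" "eval_curve q' \<noteq> 0" using assms q' by (simp_all add: eval_curve_eq_0_iff)
  ultimately show "z = eval_curve p / eval_curve q" unfolding z by (simp add: divide_simps)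
qed

lemma curve_local_ring_simps [simp]:
  "carrier (curve_local_ring f) = {Fract p q | p q. \<not> f dvd q}"
  "x \<otimes>\<^bsub>curve_local_ring f\<^esub> y = x * y" "x \<oplus>\<^bsub>curve_local_ring f\<^esub> y = x + y"
  "\<one>\<^bsub>curve_local_ring f\<^esub> = 1" "\<zero>\<^bsub>curve_local_ring f\<^esub> = 0"
  by (simp_all add: curve_local_ring_def)

lemma denominators:
  "\<not> f dvd 1" "\<not> f dvd q \<Longrightarrow> q \<noteq> 0" "\<not> f dvd q \<Longrightarrow> \<not> f dvd q' \<Longrightarrow> \<not> f dvd q * q'"
  using prime_linear_curve by (auto simp: prime_elem_dvd_mult_iff prime_elem_not_unit)

text \<open>This is the localization of the polynomial ring at the prime ideal generated by
  \<open>f\<close>; primality keeps products of denominators admissible.\<close>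

lemma ring_curve_local_ring: "ring (curve_local_ring f)"
proof -
  interpret K: ring "ring_of_type_algebra :: rat poly poly fract ring" by (rule ring_from_type_algebra)
  have "subring {Fract p q | p q. \<not> f dvd q} (ring_of_type_algebra :: rat poly poly fract ring)"
  proof (rule K.subringI)
    show "\<one>\<^bsub>ring_of_type_algebra\<^esub> \<in> {Fract p q | p q. \<not> f dvd q}"
      using denominators(1) by (auto simp: One_fract_def)
  next
    fix x y :: "rat poly poly fract"
    assume "x \<in> {Fract p q | p q. \<not> f dvd q}" "y \<in> {Fract p q | p q. \<not> f dvd q}"
    then obtain p q p' q' where xy: "x = Fract p q" "\<not> f dvd q" "y = Fract p' q'" "\<not> f dvd q'"
      by blast
    then have "q \<noteq> 0" "q' \<noteq> 0" "\<not> f dvd q * q'" using denominators by blast+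
    with xy show "x \<otimes>\<^bsub>ring_of_type_algebra\<^esub> y \<in> {Fract p q | p q. \<not> f dvd q}"
      "x \<oplus>\<^bsub>ring_of_type_algebra\<^esub> y \<in> {Fract p q | p q. \<not> f dvd q}" by (simp, blast)+
  next
    fix x :: "rat poly poly fract" assume "x \<in> {Fract p q | p q. \<not> f dvd q}"
    then obtain p q where "x = Fract p q" "\<not> f dvd q" by blast
    then show "\<ominus>\<^bsub>ring_of_type_algebra\<^esub> x \<in> {Fract p q | p q. \<not> f dvd q}" by (simp, blast)
  qed auto
  then show ?thesis unfolding curve_local_ring_def by (rule K.subring_is_ring)
qed

lemma eval_fract_ring_hom:
  "ring_hom_ring (curve_local_ring f) (ring_of_type_algebra :: rat poly fract ring) eval_fract"
proof (rule ring_hom_ringI)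
  fix x y assume "x \<in> carrier (curve_local_ring f)" "y \<in> carrier (curve_local_ring f)"
  then obtain p q p' q' where xy: "x = Fract p q" "\<not> f dvd q" "y = Fract p' q'" "\<not> f dvd q'"
    by auto
  have qq: "q \<noteq> 0" "q' \<noteq> 0" "\<not> f dvd q * q'" using xy denominators by blast+
  have ne: "eval_curve q \<noteq> 0" "eval_curve q' \<noteq> 0" using xy by (simp_all add: eval_curve_eq_0_iff)
  show "eval_fract (x \<otimes>\<^bsub>curve_local_ring f\<^esub> y) = eval_fract x \<otimes>\<^bsub>ring_of_type_algebra\<^esub> eval_fract y"
    using xy qq by (simp add: eval_fract_Fract eval_curve_hom)
  show "eval_fract (x \<oplus>\<^bsub>curve_local_ring f\<^esub> y) = eval_fract x \<oplus>\<^bsub>ring_of_type_algebra\<^esub> eval_fract y"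
    using xy qq ne by (simp add: eval_fract_Fract eval_curve_hom add_frac_eq)
next
  show "eval_fract \<one>\<^bsub>curve_local_ring f\<^esub> = \<one>\<^bsub>ring_of_type_algebra\<^esub>"
    using denominators(1) by (simp add: One_fract_def eval_fract_Fract eval_curve_hom)
qed (auto intro: ring_curve_local_ring ring_from_type_algebra)

lemma kernel_eval_fract:
  "a_kernel (curve_local_ring f) (ring_of_type_algebra :: rat poly fract ring) eval_fract = curve_ideal f"
proof -
  have "eval_fract (Fract p q) = 0 \<longleftrightarrow> f dvd p" if "\<not> f dvd q" for p q
    using that by (simp add: eval_fract_Fract eval_curve_eq_0_iff)
  then show ?thesis by (auto simp: a_kernel_def' curve_ideal_def)
qed

lemma curve_function_field_iso:
  shows "ring (curve_function_field f)"
    and "curve_const f c \<in> carrier (curve_function_field f)"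
    and "\<exists>h \<in> ring_iso (curve_function_field f) (ring_of_type_algebra :: rat poly fract ring).
        \<forall>c. h (curve_const f c) = Fract [:c:] 1"
proof -
  interpret E: ring_hom_ring "curve_local_ring f" "ring_of_type_algebra :: rat poly fract ring" eval_fract
    by (rule eval_fract_ring_hom)
  show "ring (curve_function_field f)"
    using ideal.quotient_is_ring[OF E.kernel_is_ideal]
    by (simp add: kernel_eval_fract curve_function_field_def)
  have const: "Fract [:[:c:]:] 1 \<in> carrier (curve_local_ring f)" for c
    using denominators(1) by auto
  show "curve_const f c \<in> carrier (curve_function_field f)"
    unfolding curve_const_def curve_function_field_def FactRing_simps using const by auto
  have surj: "z \<in> eval_fract ` carrier (curve_local_ring f)" for z
  proof -
    obtain a b where z: "z = Fract a b" "b \<noteq> 0" by (cases z)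
    \<comment> \<open>A nonzero polynomial in the first coordinate alone is its own value, hence
      does not vanish on the curve and may serve as a denominator.\<close>
    then have "\<not> f dvd [:b:]" by (simp add: eval_curve_hom flip: eval_curve_eq_0_iff)
    then have "z = eval_fract (Fract [:a:] [:b:])"
      using z by (subst eval_fract_Fract) (auto simp: eval_curve_hom Fract_conv_to_fract)
    moreover have "Fract [:a:] [:b:] \<in> carrier (curve_local_ring f)"
      using \<open>\<not> f dvd [:b:]\<close> by auto
    ultimately show ?thesis by blast
  qed
  have "(\<lambda>y. the_elem (eval_fract ` y)) \<in>
      ring_iso (curve_function_field f) (ring_of_type_algebra :: rat poly fract ring)"
    unfolding curve_function_field_def kernel_eval_fract[symmetric]
    by (rule E.FactRing_iso_set) (use surj in auto)
  moreover have "the_elem (eval_fract ` curve_const f c) = Fract [:c:] 1" for c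
  proof -
    have "eval_fract (Fract [:[:c:]:] 1) = Fract [:c:] 1"
      using denominators(1) by (subst eval_fract_Fract) (simp_all add: eval_curve_hom Fract_conv_to_fract)
    then show ?thesis
      using E.the_elem_simp[OF const[of c]] by (simp only: curve_const_def kernel_eval_fract)
  qed
  ultimately show "\<exists>h \<in> ring_iso (curve_function_field f) (ring_of_type_algebra :: rat poly fract ring).
        \<forall>c. h (curve_const f c) = Fract [:c:] 1" by (intro bexI allI)
qed

lemma rational_linear_curve: "rational_curve f"
  using irreducible_linear_curve curve_function_field_iso(3) unfolding rational_curve_def by blast

end

section \<open>Valuations on rational functions\<close>

lemma Fract_cases_to_fract:
  obtains a b where "x = to_fract a / to_fract b" "b \<noteq> 0"
  by (metis Fract_cases Fract_conv_to_fract)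

text \<open>The two entries are those of the normalized fraction; \<open>fract_val_quotient\<close>
  shows that any other representation gives the same difference.\<close>

definition fract_val :: "('k::field_gcd poly \<Rightarrow> int) \<Rightarrow> 'k poly fract \<Rightarrow> int" where
  "fract_val m x = m (fst (quot_of_fract x)) - m (snd (quot_of_fract x))"

text \<open>The values may be negative and need not be normalized, so that multiplicities, minus the
  degree, and the restriction of an arbitrary place to polynomials all fit.\<close>

locale poly_valuation =
  fixes m :: "'k::field_gcd poly \<Rightarrow> int"
  assumes mult: "p \<noteq> 0 \<Longrightarrow> q \<noteq> 0 \<Longrightarrow> m (p * q) = m p + m q"
    and add: "p \<noteq> 0 \<Longrightarrow> q \<noteq> 0 \<Longrightarrow> p + q \<noteq> 0 \<Longrightarrow> min (m p) (m q) \<le> m (p + q)"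
    and const: "c \<noteq> 0 \<Longrightarrow> m [:c:] = 0"
begin

lemma fract_val_quotient:
  assumes "p \<noteq> 0" "q \<noteq> 0"
  shows "fract_val m (to_fract p / to_fract q) = m p - m q"
proof -
  obtain a b where ab: "quot_of_fract (to_fract p / to_fract q) = (a, b)" by fastforce
  then have b: "b \<noteq> 0" using snd_quot_of_fract_nonzero[of "to_fract p / to_fract q"] by simp
  have "quot_to_fract (a, b) = to_fract p / to_fract q"
    using quot_to_fract_quot_of_fract[of "to_fract p / to_fract q"] ab by simp
  then have "to_fract a / to_fract b = to_fract p / to_fract q"
    by (simp add: quot_to_fract_def Fract_conv_to_fract)
  then have "to_fract (a * q) = to_fract (p * b)" using assms b by (simp add: divide_simps)
  then have eq: "a * q = p * b" by (simp only: to_fract_eq_iff)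
  then have "a \<noteq> 0" using assms b by auto
  then have "m a + m q = m p + m b" using mult assms b eq by metis
  then show ?thesis by (simp add: fract_val_def ab)
qed

lemma fract_val_const: "c \<noteq> 0 \<Longrightarrow> fract_val m (to_fract [:c:]) = 0"
  using fract_val_quotient[of "[:c:]" 1] const[of c] const[of 1] by (simp add: pCons_one)

lemma fract_val_to_fract: "p \<noteq> 0 \<Longrightarrow> fract_val m (to_fract p) = m p"
  using fract_val_quotient[of p 1] const[of 1] by (simp add: pCons_one)

lemma fract_val_mult:
  assumes "x \<noteq> 0" "y \<noteq> 0"
  shows "fract_val m (x * y) = fract_val m x + fract_val m y"
proof -
  obtain a b where x: "x = to_fract a / to_fract b" "b \<noteq> 0" by (rule Fract_cases_to_fract)
  obtain c d where y: "y = to_fract c / to_fract d" "d \<noteq> 0" by (rule Fract_cases_to_fract)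
  have ac: "a \<noteq> 0" "c \<noteq> 0" using x y assms by auto
  have "x * y = to_fract (a * c) / to_fract (b * d)" by (simp add: x y)
  then have "fract_val m (x * y) = m (a * c) - m (b * d)"
    using ac x y by (simp only:) (subst fract_val_quotient, auto)
  then show ?thesis using ac x y by (simp add: mult fract_val_quotient)
qed

lemma fract_val_add:
  assumes "x \<noteq> 0" "y \<noteq> 0" "x + y \<noteq> 0"
  shows "min (fract_val m x) (fract_val m y) \<le> fract_val m (x + y)"
proof -
  obtain a b where x: "x = to_fract a / to_fract b" "b \<noteq> 0" by (rule Fract_cases_to_fract)
  obtain c d where y: "y = to_fract c / to_fract d" "d \<noteq> 0" by (rule Fract_cases_to_fract)
  have ac: "a \<noteq> 0" "c \<noteq> 0" using x y assms by auto
  have xy: "x + y = to_fract (a * d + c * b) / to_fract (b * d)"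
    unfolding x(1) y(1) using x(2) y(2) by (simp add: add_frac_eq)
  then have ne: "a * d + c * b \<noteq> 0" using assms(3) by (metis div_0 to_fract_0)
  have "fract_val m (x + y) = m (a * d + c * b) - m (b * d)"
    unfolding xy using ne x y by (subst fract_val_quotient) auto
  moreover have "min (m (a * d)) (m (c * b)) \<le> m (a * d + c * b)"
    using ac x y ne by (intro add) auto
  ultimately show ?thesis using ac x y by (simp add: mult fract_val_quotient min_def split: if_splits)
qed

text \<open>Powers of an element of value 1 and their inverses take every value. The alternative -1
  is for the order at infinity, where the indeterminate has a pole.\<close>

lemma fract_val_surj:
  assumes "p \<noteq> 0" "m p = 1 \<or> m p = -1"
  obtains x where "x \<noteq> 0" "fract_val m x = n"
proof -
  have one: "fract_val m 1 = 0" using fract_val_const[of 1] by (simp add: pCons_one)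
  define x where "x = (if m p = 1 then to_fract p else inverse (to_fract p))"
  have x0: "x \<noteq> 0" using assms by (simp add: x_def)
  have inv: "fract_val m (inverse y) = - fract_val m y" if "y \<noteq> 0" for y
    using fract_val_mult[of y "inverse y"] that one by simp
  have x1: "fract_val m x = 1" using assms inv[of "to_fract p"] by (auto simp: x_def fract_val_to_fract)
  have "fract_val m (x ^ k) = int k" for k
    by (induction k) (simp_all add: one x0 x1 fract_val_mult)
  then have "fract_val m (if n \<ge> 0 then x ^ nat n else inverse (x ^ nat (- n))) = n"
    by (simp add: inv x0)
  then show thesis using that x0 by (metis inverse_nonzero_iff_nonzero power_not_zero)
qed

end

lemma poly_valuation_multiplicity:
  fixes P :: "'k::field_gcd poly"
  assumes P: "Factorial_Ring.prime P"
  shows "poly_valuation (\<lambda>p. int (multiplicity P p))"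
proof
  fix p q :: "'k poly" and c :: 'k
  have P': "prime_elem P" "\<not> is_unit P" using P by (auto simp: Factorial_Ring.prime_def prime_elem_def)
  show "int (multiplicity P (p * q)) = int (multiplicity P p) + int (multiplicity P q)"
    if "p \<noteq> 0" "q \<noteq> 0"
    using that P' by (simp add: prime_elem_multiplicity_mult_distrib)
  show "min (int (multiplicity P p)) (int (multiplicity P q)) \<le> int (multiplicity P (p + q))"
    if "p \<noteq> 0" "q \<noteq> 0" "p + q \<noteq> 0"
  proof -
    let ?n = "min (multiplicity P p) (multiplicity P q)"
    have "P ^ ?n dvd p" "P ^ ?n dvd q" by (auto intro: multiplicity_dvd')
    then have "P ^ ?n dvd p + q" by simp
    then have "?n \<le> multiplicity P (p + q)" using that P' by (intro multiplicity_geI) auto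
    then show ?thesis by linarith
  qed
  show "int (multiplicity P [:c:]) = 0" if "c \<noteq> 0"
    using that by (simp add: multiplicity_unit_right is_unit_const_poly_iff dvd_field_iff)
qed

lemma poly_valuation_degree: "poly_valuation (\<lambda>p :: 'k::field_gcd poly. - int (Polynomial.degree p))"
proof
  fix p q :: "'k poly" and c :: 'k
  show "- int (Polynomial.degree (p * q)) = - int (Polynomial.degree p) + - int (Polynomial.degree q)"
    if "p \<noteq> 0" "q \<noteq> 0" using that by (simp add: degree_mult_eq)
  show "min (- int (Polynomial.degree p)) (- int (Polynomial.degree q)) \<le> - int (Polynomial.degree (p + q))"
    using degree_add_le_max[of p q] by (auto simp: min_def max_def split: if_splits)
qed simp

text \<open>Ostrowski's theorem for rational function fields: if \<open>m\<close> is non-negative on polynomials,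
  then it is determined by a polynomial of minimal degree on which it is positive; otherwise it is
  already negative on the indeterminate.\<close>

lemma (in poly_valuation) classification:
  assumes onto: "\<And>d. (\<And>p. p \<noteq> 0 \<Longrightarrow> d dvd m p) \<Longrightarrow> d dvd 1"
  obtains P where "Factorial_Ring.prime P" "\<And>p. p \<noteq> 0 \<Longrightarrow> m p = int (multiplicity P p)"
    | "\<And>p. p \<noteq> 0 \<Longrightarrow> m p = - int (Polynomial.degree p)"
proof (cases "\<forall>p. p \<noteq> 0 \<longrightarrow> 0 \<le> m p")
  case True
  have unit: "m p = 0" if "is_unit p" for p
  proof -
    from that obtain c where "p = [:c:]" "c dvd 1" by (rule is_unit_polyE)
    then show ?thesis using const[of c] by (cases "c = 0") auto
  qed
  have "\<exists>p. p \<noteq> 0 \<and> 0 < m p"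
  proof (rule ccontr)
    assume "\<nexists>p. p \<noteq> 0 \<and> 0 < m p"
    then have "m p = 0" if "p \<noteq> 0" for p using True that by force
    \<comment> \<open>If all values were 0, the number 2 would divide every one of them.\<close>
    then show False using onto[of 2] by simp
  qed
  then obtain p0 where "p0 \<noteq> 0 \<and> 0 < m p0" by blast
  then obtain Q where Q: "Q \<noteq> 0" "0 < m Q"
    and minimal: "\<And>p. p \<noteq> 0 \<Longrightarrow> 0 < m p \<Longrightarrow> Polynomial.degree Q \<le> Polynomial.degree p"
    using ex_has_least_nat[of "\<lambda>p. p \<noteq> 0 \<and> 0 < m p" p0 Polynomial.degree] by blast
  \<comment> \<open>\<open>prime\<close> demands a normalized element; the unit factor has value 0,
    so value and degree are unchanged.\<close>
  define P where "P = normalize Q"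
  have "Q = P * unit_factor Q" by (simp add: P_def)
  moreover have "m (P * unit_factor Q) = m P + m (unit_factor Q)"
    using Q by (intro mult) (auto simp: P_def)
  moreover have "m (unit_factor Q) = 0" using Q by (intro unit) simp
  ultimately have P: "P \<noteq> 0" "0 < m P" using Q by (auto simp: P_def)
  have "P dvd Q" "Q dvd P" by (simp_all add: P_def)
  then have deg: "Polynomial.degree P = Polynomial.degree Q"
    using P Q by (meson dvd_imp_degree_le order_antisym)
  have dvd_iff: "P dvd p \<longleftrightarrow> 0 < m p" if p: "p \<noteq> 0" for p
  proof
    assume "P dvd p"
    then obtain q where q: "p = P * q" by blast
    with p have "m p = m P + m q" by (auto simp: mult)
    with P True q p show "0 < m p" by (metis add_pos_nonneg mult_zero_right)
  next
    assume pos: "0 < m p"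
    show "P dvd p"
    proof (rule ccontr)
      assume ndvd: "\<not> P dvd p"
      \<comment> \<open>The remainder has smaller degree than \<open>P\<close>, so minimality denies
        it a positive value; yet it is the sum of \<open>p\<close> and a multiple of
        \<open>P\<close>, both of positive value.\<close>
      define r where "r = p mod P"
      have r: "r \<noteq> 0" using ndvd by (simp add: r_def dvd_eq_mod_eq_0)
      have "Polynomial.degree r < Polynomial.degree P"
        using degree_mod_less[of P p] P r by (auto simp: r_def)
      then have "m r \<le> 0" using minimal[OF r] deg by linarith
      have req: "r = p + P * (- (p div P))"
        using div_mult_mod_eq[of p P] by (simp add: r_def algebra_simps)
      show False
      proof (cases "p div P = 0")
        case True
        then show False using req pos \<open>m r \<le> 0\<close> by simp
      next
        case False
        then have "m (P * (- (p div P))) = m P + m (- (p div P))" using P by (intro mult) auto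
        moreover have "0 \<le> m (- (p div P))" using True False by simp
        ultimately have "0 < min (m p) (m (P * (- (p div P))))" using P pos by simp
        also have "\<dots> \<le> m r" using add[of p "P * (- (p div P))"] req r p P False by simp
        finally show False using \<open>m r \<le> 0\<close> by simp
      qed
    qed
  qed
  have "\<not> is_unit P" using unit P by force
  moreover have "P dvd a \<or> P dvd b" if "P dvd a * b" for a b
  proof (cases "a = 0 \<or> b = 0")
    case False
    then have "0 < m a + m b" using dvd_iff[of "a * b"] that mult[of a b] by simp
    then show ?thesis using dvd_iff False by (metis add_nonpos_nonpos linorder_not_less)
  qed auto
  ultimately have prime: "Factorial_Ring.prime P"
    using P by (auto simp: Factorial_Ring.prime_def prime_elem_def P_def)
  have mP: "m p = int (multiplicity P p) * m P" if p: "p \<noteq> 0" for p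
  proof -
    obtain y where y: "p = P ^ multiplicity P p * y" "\<not> P dvd y"
      using multiplicity_decompose'[OF p \<open>\<not> is_unit P\<close>] by blast
    have y0: "y \<noteq> 0" using y by auto
    have "m y = 0" using dvd_iff[OF y0] y(2) True y0 by force
    have "m (P ^ k) = int k * m P" for k
      by (induction k) (use P in \<open>simp_all add: unit mult algebra_simps\<close>)
    then show ?thesis
      using mult[of "P ^ multiplicity P p" y] P y0 y(1) \<open>m y = 0\<close> by simp
  qed
  \<comment> \<open>Every value is a multiple of \<open>m P\<close>, so the normalization
    \<open>onto\<close> leaves only \<open>m P = 1\<close>.\<close>
  then have "m P dvd 1" using onto by simp
  then have "m P = 1" using P by simp
  then show thesis using that(1)[OF prime] mP by simp
next
  case False
  define t :: "'k poly" where "t = [:0, 1:]"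
  have t0: "t \<noteq> 0" by (simp add: t_def)
  have pt: "pCons c p = [:c:] + t * p" for c p by (simp add: t_def)
  have "m t < 0"
  proof (rule ccontr)
    assume "\<not> m t < 0"
    \<comment> \<open>Building a polynomial up from its coefficients uses only constants, of value
      0, and multiplication by \<open>t\<close>; were \<open>m t\<close> non-negative, no polynomial
      could have a negative value.\<close>
    have "0 \<le> m p" if "p \<noteq> 0" for p
      using that
    proof (induction p)
      case (pCons c p)
      show ?case
      proof (cases "p = 0")
        case True
        then show ?thesis using pCons const by simp
      next
        case False
        then have tp: "0 \<le> m (t * p)" using pCons \<open>\<not> m t < 0\<close> mult[OF t0] by simp
        show ?thesis
        proof (cases "c = 0")
          case True
          then show ?thesis using tp unfolding pt[of c p] by simp
        next
          case c: False
          have ne: "[:c:] + t * p \<noteq> 0" using pCons(1) unfolding pt[of c p, symmetric] by auto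
          have "0 \<le> min (m [:c:]) (m (t * p))" using c tp const by simp
          also have "\<dots> \<le> m ([:c:] + t * p)"
            using c t0 False pCons(1) ne by (intro add) auto
          finally show ?thesis unfolding pt[of c p] .
        qed
      qed
    qed simp
    with False show False by auto
  qed
  have mt: "m p = int (Polynomial.degree p) * m t" if "p \<noteq> 0" for p
    using that
  proof (induction p)
    case (pCons c p)
    show ?case
    proof (cases "p = 0")
      case True
      then show ?thesis using pCons const by simp
    next
      case False
      then have IH: "m (t * p) = int (Polynomial.degree (pCons c p)) * m t"
        using pCons mult[OF t0] by (simp add: algebra_simps)
      then have neg: "m (t * p) < 0" using False \<open>m t < 0\<close> by (simp add: mult_pos_neg)
      show ?thesis
      proof (cases "c = 0")
        case True
        then show ?thesis using IH unfolding pt[of c p] by simp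
      next
        case c: False
        have ne: "[:c:] + t * p \<noteq> 0" using pCons(1) unfolding pt[of c p, symmetric] by auto
        have "min (m [:c:]) (m (t * p)) \<le> m ([:c:] + t * p)"
          using c t0 False ne by (intro add) auto
        \<comment> \<open>The ultrametric inequality is an equality when the two values differ:
          \<open>t * p\<close> has negative value and \<open>c\<close> has value 0, and adding
          \<open>- c\<close> back yields the reverse estimate. Thus the leading term determines the
          value.\<close>
        moreover have "[:c:] + t * p + [:- c:] = t * p + ([:c:] + [:- c:])" by (simp only: ac_simps)
        then have sum: "[:c:] + t * p + [:- c:] = t * p" by simp
        have "min (m ([:c:] + t * p)) (m [:- c:]) \<le> m ([:c:] + t * p + [:- c:])"
          using c ne by (intro add) (use t0 False in \<open>simp_all add: sum\<close>)
        note this[unfolded sum]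
        ultimately have "m ([:c:] + t * p) = m (t * p)"
          using neg const[of c] const[of "- c"] c by (simp add: min_def split: if_splits)
        then show ?thesis using IH unfolding pt[of c p] by simp
      qed
    qed
  qed simp
  then have "m t dvd 1" using onto by simp
  then have "m t = - 1" using \<open>m t < 0\<close> by (metis int_one_le_iff_zero_less less_le not_less zdvd1_eq abs_if minus_equation_iff)
  then show thesis using that(2) mt by simp
qed

section \<open>The genus of a rational function field\<close>

text \<open>The strict bound makes \<open>n\<close> the dimension. The disjunct \<open>p = 0\<close>
  makes the case \<open>n = 0\<close> the zero space, which is what divisors of negative degree
  require.\<close>

definition low_degree :: "nat \<Rightarrow> 'k::field_gcd poly set" where
  "low_degree n = {p. p = 0 \<or> Polynomial.degree p < n}"

lemma low_degree_iff: "p \<in> low_degree n \<longleftrightarrow> (\<forall>i\<ge>n. Polynomial.coeff p i = 0)"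
proof
  assume r: "\<forall>i\<ge>n. Polynomial.coeff p i = 0"
  show "p \<in> low_degree n"
    using r[rule_format, of "Polynomial.degree p"] by (auto simp: low_degree_def not_less)
qed (auto simp: low_degree_def coeff_eq_0)

lemma low_degree_mono: "m \<le> n \<Longrightarrow> p \<in> low_degree m \<Longrightarrow> p \<in> low_degree n"
  by (auto simp: low_degree_iff)

lemma low_degree_closed:
  "p \<in> low_degree n \<Longrightarrow> q \<in> low_degree n \<Longrightarrow> p + q \<in> low_degree n"
  "p \<in> low_degree n \<Longrightarrow> smult c p \<in> low_degree n"
  "Polynomial.monom c n \<in> low_degree (Suc n)" "0 \<in> low_degree n"
  by (auto simp: low_degree_iff)

lemma low_degree_0: "low_degree 0 = {0}"
  by (auto simp: low_degree_def)

text \<open>The image of the monomial of degree \<open>n\<close> extends the space by one line. The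
  bound \<open>d\<close> stays fixed while \<open>n\<close> grows because \<open>\<phi>\<close> may
  be well behaved only in low degrees: reduction modulo a prime \<open>P\<close> is injective only
  below the degree of \<open>P\<close>.\<close>

lemma (in ring) dimension_low_degree:
  fixes \<kappa> :: "'k::field_gcd \<Rightarrow> 'a"
  assumes closed: "\<And>p. p \<in> low_degree d \<Longrightarrow> \<phi> p \<in> carrier R"
    and add: "\<And>p q. p \<in> low_degree d \<Longrightarrow> q \<in> low_degree d \<Longrightarrow> \<phi> (p + q) = \<phi> p \<oplus> \<phi> q"
    and smult: "\<And>c p. p \<in> low_degree d \<Longrightarrow> \<phi> (smult c p) = \<kappa> c \<otimes> \<phi> p"
    and inj: "\<And>p. p \<in> low_degree d \<Longrightarrow> \<phi> p = \<zero> \<Longrightarrow> p = 0"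
    and "n \<le> d"
  shows "dimension n (range \<kappa>) (\<phi> ` low_degree n)"
  using \<open>n \<le> d\<close>
proof (induction n)
  case 0
  have "\<phi> (0 + 0) = \<phi> 0 \<oplus> \<phi> 0" by (rule add) (simp_all add: low_degree_closed)
  then have "\<phi> 0 = \<zero>" using closed[of 0] by (simp add: low_degree_closed)
  then show ?case by (simp add: low_degree_0)
next
  case (Suc n)
  have sub: "p \<in> low_degree d" if "p \<in> low_degree n \<or> p \<in> low_degree (Suc n)" for p
    using that Suc.prems low_degree_mono by (metis Suc_leD)
  define v where "v = \<phi> (Polynomial.monom 1 n)"
  have mon: "Polynomial.monom c n \<in> low_degree d" for c by (intro sub disjI2 low_degree_closed)
  have "v \<notin> \<phi> ` low_degree n"
  proof
    assume "v \<in> \<phi> ` low_degree n"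
    then obtain p where p: "p \<in> low_degree n" "v = \<phi> p" by blast
    \<comment> \<open>Additivity and homogeneity are assumed only in low degrees, so the difference
      is formed with the scalar -1; its coefficient at \<open>n\<close> is 1, which contradicts
      injectivity.\<close>
    let ?q = "Polynomial.monom 1 n + smult (- 1) p"
    have q: "smult (- 1) p \<in> low_degree d" using p by (intro sub low_degree_closed disjI1)
    have "\<phi> ?q = \<phi> p \<oplus> \<phi> (smult (- 1) p)" using add[OF mon q] p by (simp add: v_def)
    also have "\<dots> = \<phi> (p + smult (- 1) p)" using p q sub add by metis
    also have "\<dots> = \<phi> (smult 0 p)" by simp
    also have "\<dots> = \<phi> 0" by simp
    also have "\<dots> = \<zero>"
    proof -
      have "\<phi> (0 + 0) = \<phi> 0 \<oplus> \<phi> 0" by (rule add) (simp_all add: low_degree_closed)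
      then show ?thesis using closed[of 0] by (simp add: low_degree_closed)
    qed
    finally have "?q = 0" by (intro inj low_degree_closed mon q)
    then have "Polynomial.coeff ?q n = 0" by simp
    then show False using p by (simp add: low_degree_iff)
  qed
  moreover have "v \<in> carrier R" unfolding v_def by (intro closed mon)
  moreover have "line_extension (range \<kappa>) v (\<phi> ` low_degree n) = \<phi> ` low_degree (Suc n)"
  proof -
    have eq: "\<kappa> c \<otimes> v \<oplus> \<phi> p = \<phi> (Polynomial.monom c n + p)" if "p \<in> low_degree n" for c p
      using add[OF mon[of c] sub[of p]] smult[OF mon[of 1], of c] that by (simp add: v_def smult_monom)
    have "\<exists>c p'. p' \<in> low_degree n \<and> p = Polynomial.monom c n + p'" if "p \<in> low_degree (Suc n)" for p :: "'k poly"
    proof (intro exI conjI)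
      show "p - Polynomial.monom (Polynomial.coeff p n) n \<in> low_degree n"
        unfolding low_degree_iff
      proof (intro allI impI)
        fix i assume "n \<le> i"
        then show "Polynomial.coeff (p - Polynomial.monom (Polynomial.coeff p n) n) i = 0"
          using that by (cases "i = n") (simp_all add: low_degree_iff)
      qed
    qed simp
    moreover have "Polynomial.monom c n + p \<in> low_degree (Suc n)" if "p \<in> low_degree n" for c :: 'k and p
      using that by (intro low_degree_closed) (auto simp: low_degree_def)
    ultimately show ?thesis
      unfolding set_eq_iff line_extension_mem_iff by (auto simp: eq image_iff)
  qed
  ultimately show ?case using Suc by (metis Suc_dim Suc_leD)
qed

text \<open>Elements of the function field of a curve are cosets. Fixing an isomorphism
  \<open>g\<close> from the rational functions lets all computations be made with fractions of
  polynomials, while the notions of place, degree and genus stay on \<open>F\<close>.\<close>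

locale rational_function_field =
  fixes F :: "('a, 'm) ring_scheme" (structure) and g :: "'k::field_gcd poly fract \<Rightarrow> 'a"
  assumes ring: "Ring.ring F" and iso: "g \<in> ring_iso ring_of_type_algebra F"
begin

definition constants :: "'a set" where
  "constants = range (\<lambda>c. g (to_fract [:c:]))"

sublocale F: ring_hom_ring "ring_of_type_algebra :: 'k poly fract ring" F g
  using ring iso by (intro ring_hom_ringI2 ring_from_type_algebra) (auto simp: ring_iso_def)

sublocale Ring.field F
proof -
  have "Ring.field (F\<lparr>zero := g \<zero>\<^bsub>ring_of_type_algebra\<^esub>\<rparr>)"
    by (rule field.ring_iso_imp_img_field[OF field_from_type_algebra iso])
  then show "Ring.field F" using F.hom_zero by simp
qed

lemma g_0: "\<zero> = g 0" and g_1: "\<one> = g 1"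
  using F.hom_zero F.hom_one by simp_all

lemma g_simps [simp]:
  "g x \<otimes> g y = g (x * y)" "g x \<oplus> g y = g (x + y)" "g x \<in> carrier F"
  "g x = g y \<longleftrightarrow> x = y" "g x = \<zero> \<longleftrightarrow> x = 0"
  using F.hom_mult[of x y] F.hom_add[of x y] F.hom_closed[of x] F.hom_zero iso
  by (auto simp: ring_iso_def bij_betw_def inj_on_def)

lemma carrier_eq: "carrier F = range g"
  using iso by (auto simp: ring_iso_def bij_betw_def)

lemma carrier_cases:
  assumes "y \<in> carrier F"
  obtains x where "y = g x"
  using assms carrier_eq by blast

lemma g_minus: "\<ominus> g x = g (- x)"
  by (rule F.S.minus_equality) (simp_all add: g_0)

lemma const_hom: "ring_hom_ring (ring_of_type_algebra :: 'k ring) F (\<lambda>c. g (to_fract [:c:]))"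
  by (rule ring_hom_ringI) (auto intro: ring_from_type_algebra ring simp: g_1 pCons_one simp flip: to_fract_add to_fract_mult)

lemma subfield_constants: "subfield constants F"
proof -
  interpret k: ring_hom_ring "ring_of_type_algebra :: 'k ring" F "\<lambda>c. g (to_fract [:c:])"
    by (rule const_hom)
  have "subfield (carrier ring_of_type_algebra) (ring_of_type_algebra :: 'k ring)"
    by (rule field.carrier_is_subfield) (rule field_from_type_algebra)
  from k.img_is_subfield(2)[OF this] show ?thesis by (simp add: constants_def)
qed

section \<open>The places of a rational function field\<close>

definition place_of :: "('k poly \<Rightarrow> int) \<Rightarrow> 'a \<Rightarrow> int" where
  "place_of m = (\<lambda>y \<in> carrier F - {\<zero>}. fract_val m (inv_into UNIV g y))"

lemma place_of_g: "x \<noteq> 0 \<Longrightarrow> place_of m (g x) = fract_val m x"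
proof -
  assume "x \<noteq> 0"
  moreover have "inj g" by (auto simp: inj_on_def)
  ultimately show ?thesis by (simp add: place_of_def)
qed

lemma Diff_zero_eq: "carrier F - {\<zero>} = g ` (- {0})"
  by (auto simp: carrier_eq g_0)

lemma places_iff:
  "v \<in> places F constants \<longleftrightarrow> v \<in> extensional (carrier F - {\<zero>}) \<and>
    (\<forall>n. \<exists>x. x \<noteq> 0 \<and> v (g x) = n) \<and>
    (\<forall>x y. x \<noteq> 0 \<longrightarrow> y \<noteq> 0 \<longrightarrow> v (g (x * y)) = v (g x) + v (g y)) \<and>
    (\<forall>x y. x \<noteq> 0 \<longrightarrow> y \<noteq> 0 \<longrightarrow> x + y \<noteq> 0 \<longrightarrow> min (v (g x)) (v (g y)) \<le> v (g (x + y))) \<and>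
    (\<forall>c. c \<noteq> 0 \<longrightarrow> v (g (to_fract [:c:])) = 0)"
proof -
  have "v ` g ` (- {0}) = UNIV \<longleftrightarrow> (\<forall>n. \<exists>x. x \<noteq> 0 \<and> v (g x) = n)"
    by (auto simp: set_eq_iff image_iff Bex_def) metis+
  moreover have "(\<forall>c\<in>constants - {\<zero>}. v c = 0) \<longleftrightarrow> (\<forall>c. c \<noteq> 0 \<longrightarrow> v (g (to_fract [:c:])) = 0)"
    by (auto simp: constants_def)
  moreover have "(\<forall>x \<in> - {0}. Q x) \<longleftrightarrow> (\<forall>x. x \<noteq> 0 \<longrightarrow> Q x)" for Q :: "'k poly fract \<Rightarrow> bool"
    by auto
  ultimately show ?thesis
    unfolding places_def Diff_zero_eq by simp
qed

lemma place_of_in_places: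
  assumes "poly_valuation m" "p \<noteq> 0" "m p = 1 \<or> m p = - 1"
  shows "place_of m \<in> places F constants"
proof -
  interpret poly_valuation m by fact
  show ?thesis
    unfolding places_iff
  proof (intro conjI allI impI)
    show "\<exists>x. x \<noteq> 0 \<and> place_of m (g x) = n" for n
      using fract_val_surj[OF assms(2,3), of n] place_of_g by metis
    show "place_of m \<in> extensional (carrier F - {\<zero>})" by (simp add: place_of_def)
  qed (auto simp: place_of_g fract_val_mult fract_val_add fract_val_const)
qed

abbreviation vprime :: "'k poly \<Rightarrow> 'a \<Rightarrow> int" where
  "vprime P \<equiv> place_of (\<lambda>p. int (multiplicity P p))"

abbreviation vinf :: "'a \<Rightarrow> int" where
  "vinf \<equiv> place_of (\<lambda>p. - int (Polynomial.degree p))"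

lemma vprime_quotient:
  "Factorial_Ring.prime P \<Longrightarrow> p \<noteq> 0 \<Longrightarrow> q \<noteq> 0 \<Longrightarrow>
    vprime P (g (to_fract p / to_fract q)) = int (multiplicity P p) - int (multiplicity P q)"
  by (simp add: place_of_g poly_valuation.fract_val_quotient[OF poly_valuation_multiplicity])

lemma vinf_quotient:
  "p \<noteq> 0 \<Longrightarrow> q \<noteq> 0 \<Longrightarrow>
    vinf (g (to_fract p / to_fract q)) = int (Polynomial.degree q) - int (Polynomial.degree p)"
  by (simp add: place_of_g poly_valuation.fract_val_quotient[OF poly_valuation_degree])

text \<open>A place is determined by its values on polynomials, and these satisfy the axioms of
  \<open>poly_valuation\<close>, so the classification applies.\<close>

lemma places_eq: "places F constants = insert vinf (vprime ` {P. Factorial_Ring.prime P})"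
proof (intro equalityI subsetI)
  fix v assume "v \<in> insert vinf (vprime ` {P. Factorial_Ring.prime P})"
  then consider "v = vinf" | P where "Factorial_Ring.prime P" "v = vprime P" by blast
  then show "v \<in> places F constants"
  proof cases
    case 1
    show ?thesis unfolding 1
      by (rule place_of_in_places[OF poly_valuation_degree, of "[:0, 1:]"]) auto
  next
    case (2 P)
    then have "P \<noteq> 0" "\<not> is_unit P" by (auto simp: Factorial_Ring.prime_def prime_elem_def)
    then show ?thesis unfolding 2(2)
      by (intro place_of_in_places[OF poly_valuation_multiplicity[OF 2(1)], of P]) (auto simp: multiplicity_self)
  qed
next
  fix v assume v: "v \<in> places F constants"
  note V = v[unfolded places_iff]
  define m where "m p = v (g (to_fract p))" for p
  interpret m: poly_valuation m
  proof
    fix p q :: "'k poly" assume "p \<noteq> 0" "q \<noteq> 0"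
    then show "m (p * q) = m p + m q" using V by (simp add: m_def)
    assume "p + q \<noteq> 0"
    then have "to_fract p + to_fract q \<noteq> 0" by (metis to_fract_add to_fract_eq_0_iff)
    then show "min (m p) (m q) \<le> m (p + q)"
      using V \<open>p \<noteq> 0\<close> \<open>q \<noteq> 0\<close> by (simp add: m_def)
  qed (use V in \<open>simp add: m_def\<close>)
  have v_eq: "v = place_of m"
  proof
    fix y show "v y = place_of m y"
    proof (cases "y \<in> carrier F - {\<zero>}")
      case True
      then obtain x where y: "y = g x" "x \<noteq> 0" unfolding Diff_zero_eq by blast
      obtain a b where x: "x = to_fract a / to_fract b" "b \<noteq> 0" by (rule Fract_cases_to_fract)
      then have "a \<noteq> 0" using y by auto
      have "x * to_fract b = to_fract a" using x by simp
      then have "v (g x) + v (g (to_fract b)) = v (g (to_fract a))" using V y x by (metis to_fract_eq_0_iff)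
      then have "v (g x) = fract_val m x"
        using x \<open>a \<noteq> 0\<close> by (simp add: m.fract_val_quotient m_def)
      then show ?thesis using y by (simp add: place_of_g)
    next
      case False
      then show ?thesis
        using extensional_arb[OF V[THEN conjunct1] False] by (simp only: place_of_def restrict_apply False if_False)
    qed
  qed
  \<comment> \<open>Some fraction \<open>a / b\<close> has value 1, hence a common divisor of the
    values of all polynomials divides \<open>m a - m b = 1\<close>.\<close>
  have "d dvd 1" if "\<And>p. p \<noteq> 0 \<Longrightarrow> d dvd m p" for d
  proof -
    obtain x where x: "x \<noteq> 0" "v (g x) = 1"
      using V[THEN conjunct2, THEN conjunct1, rule_format, of 1] by blast
    obtain a b where ab: "x = to_fract a / to_fract b" "b \<noteq> 0" by (rule Fract_cases_to_fract)
    then have "a \<noteq> 0" using x by auto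
    then have "m a - m b = 1" using x ab by (simp add: v_eq place_of_g m.fract_val_quotient)
    then show ?thesis using that[OF \<open>a \<noteq> 0\<close>] that[OF ab(2)] by (metis dvd_diff)
  qed
  note onto = this
  have place_of_cong: "v = place_of m'" if "poly_valuation m'" and eq: "\<And>p. p \<noteq> 0 \<Longrightarrow> m p = m' p" for m'
  proof -
    have "fract_val m x = fract_val m' x" if "x \<noteq> 0" for x
    proof -
      obtain a b where ab: "x = to_fract a / to_fract b" "b \<noteq> 0" by (rule Fract_cases_to_fract)
      then have "a \<noteq> 0" using that by auto
      with ab show ?thesis
        using eq by (simp add: m.fract_val_quotient poly_valuation.fract_val_quotient[OF \<open>poly_valuation m'\<close>])
    qed
    then have "place_of m (g x) = place_of m' (g x)" if "x \<noteq> 0" for x using that by (simp add: place_of_g)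
    then show ?thesis
      unfolding v_eq place_of_def using Diff_zero_eq by (intro restrict_ext) (auto simp: place_of_def)
  qed
  show "v \<in> insert vinf (vprime ` {P. Factorial_Ring.prime P})"
    using m.classification[OF onto] place_of_cong poly_valuation_multiplicity poly_valuation_degree
    by (smt (verit) image_eqI insertCI mem_Collect_eq)
qed

text \<open>The order of \<open>P\<close> at its own place is 1, and an equal order at
  \<open>Q\<close> forces \<open>Q\<close> to divide \<open>P\<close>. Injectivity turns sums over
  places into sums over primes.\<close>

lemma inj_vprime: "inj_on vprime {P. Factorial_Ring.prime P}"
proof (rule inj_onI, clarsimp)
  fix P Q :: "'k poly" assume P: "Factorial_Ring.prime P" and Q: "Factorial_Ring.prime Q"
    and eq: "vprime P = vprime Q"
  have ne: "P \<noteq> 0" "\<not> is_unit P" using P by (auto simp: Factorial_Ring.prime_def prime_elem_def)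
  have "vprime P (g (to_fract P)) = 1" "vprime Q (g (to_fract P)) = int (multiplicity Q P)"
    using vprime_quotient[OF P, of P 1] vprime_quotient[OF Q, of P 1] ne by (simp_all add: multiplicity_self)
  then have "multiplicity Q P = 1" using eq by simp
  then have "Q dvd P" using not_dvd_imp_multiplicity_0 by fastforce
  then show "P = Q" using P Q primes_dvd_imp_eq by metis
qed

lemma vinf_not_vprime: "Factorial_Ring.prime P \<Longrightarrow> vinf \<noteq> vprime P"
proof
  assume P: "Factorial_Ring.prime P" and eq: "vinf = vprime P"
  have "vprime P (g (to_fract [:0, 1:])) \<ge> 0" "vinf (g (to_fract [:0, 1:])) = - 1"
    using vprime_quotient[OF P, of "[:0, 1:]" 1] vinf_quotient[of "[:0, 1:]" 1] by simp_all
  then show False using eq by simp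
qed

section \<open>Residue fields and degrees of places\<close>

context
  fixes v assumes v: "v \<in> places F constants"
begin

lemma place_mult: "x \<noteq> 0 \<Longrightarrow> y \<noteq> 0 \<Longrightarrow> v (g (x * y)) = v (g x) + v (g y)"
  and place_add: "x \<noteq> 0 \<Longrightarrow> y \<noteq> 0 \<Longrightarrow> x + y \<noteq> 0 \<Longrightarrow> min (v (g x)) (v (g y)) \<le> v (g (x + y))"
  and place_const: "c \<noteq> 0 \<Longrightarrow> v (g (to_fract [:c:])) = 0"
  using v[unfolded places_iff, THEN conjunct2, THEN conjunct2] by simp_all

lemma place_1: "v (g 1) = 0"
  using place_const[of 1] by (simp add: pCons_one)

lemma place_minus: "v (g (- x)) = v (g x)"
proof (cases "x = 0")
  case False
  have "[:-1:] = - (1 :: 'k poly)" by (simp add: one_pCons)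
  then have "- x = to_fract [:-1:] * x" by simp
  then show ?thesis using place_mult[of "to_fract [:-1:]" x] place_const[of "-1"] False by simp
qed simp

lemma place_ring_simps [simp]:
  "x \<otimes>\<^bsub>place_ring F v\<^esub> y = x \<otimes> y" "x \<oplus>\<^bsub>place_ring F v\<^esub> y = x \<oplus> y"
  "\<one>\<^bsub>place_ring F v\<^esub> = \<one>" "\<zero>\<^bsub>place_ring F v\<^esub> = \<zero>"
  by (simp_all add: place_ring_def)

lemma in_place_ring: "g x \<in> carrier (place_ring F v) \<longleftrightarrow> x = 0 \<or> 0 \<le> v (g x)"
  and in_place_ideal: "g x \<in> place_ideal F v \<longleftrightarrow> x = 0 \<or> 0 < v (g x)"
  by (simp_all add: place_ring_def place_ideal_def)

lemma place_ring_cases: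
  assumes "y \<in> carrier (place_ring F v)"
  obtains x where "y = g x" "x = 0 \<or> 0 \<le> v (g x)"
proof -
  have "y \<in> carrier F" using assms by (simp add: place_ring_def)
  then obtain x where "y = g x" by (rule carrier_cases)
  then show thesis using that[of x] assms by (simp add: in_place_ring)
qed

lemma place_ideal_cases:
  assumes "y \<in> place_ideal F v"
  obtains x where "y = g x" "x = 0 \<or> 0 < v (g x)"
proof -
  have "y \<in> carrier F" using assms by (simp add: place_ideal_def)
  then obtain x where "y = g x" by (rule carrier_cases)
  then show thesis using that[of x] assms by (simp add: in_place_ideal)
qed

lemma place_ring_add:
  assumes "x = 0 \<or> 0 \<le> v (g x)" "y = 0 \<or> 0 \<le> v (g y)"
  shows "x + y = 0 \<or> 0 \<le> v (g (x + y))"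
  using assms place_add[of x y] by (cases "x = 0"; cases "y = 0"; cases "x + y = 0") auto

lemma place_ideal_add:
  assumes "x = 0 \<or> 0 < v (g x)" "y = 0 \<or> 0 < v (g y)"
  shows "x + y = 0 \<or> 0 < v (g (x + y))"
  using assms place_add[of x y] by (cases "x = 0"; cases "y = 0"; cases "x + y = 0") auto

lemma ring_place_ring: "Ring.ring (place_ring F v)"
proof -
  have "subring (carrier (place_ring F v)) F"
  proof (rule F.S.subringI)
    show "carrier (place_ring F v) \<subseteq> carrier F" by (auto simp: place_ring_def)
    show "\<one> \<in> carrier (place_ring F v)" by (simp add: g_1 in_place_ring place_1)
  next
    fix y assume "y \<in> carrier (place_ring F v)"
    then show "\<ominus> y \<in> carrier (place_ring F v)"
      by (elim place_ring_cases) (auto simp: g_minus in_place_ring place_minus)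
  next
    fix y z assume "y \<in> carrier (place_ring F v)" "z \<in> carrier (place_ring F v)"
    then obtain a b where ab: "y = g a" "a = 0 \<or> 0 \<le> v (g a)" "z = g b" "b = 0 \<or> 0 \<le> v (g b)"
      by (meson place_ring_cases)
    then show "y \<oplus> z \<in> carrier (place_ring F v)" by (simp add: in_place_ring place_ring_add)
    show "y \<otimes> z \<in> carrier (place_ring F v)"
      using ab place_mult[of a b] by (cases "a = 0"; cases "b = 0") (auto simp: in_place_ring)
  qed
  from F.S.subring_is_ring[OF this] show ?thesis by (simp add: place_ring_def)
qed

interpretation VR: Ring.ring "place_ring F v"
  by (rule ring_place_ring)

lemma place_ring_minus:
  assumes "x = 0 \<or> 0 \<le> v (g x)"
  shows "\<ominus>\<^bsub>place_ring F v\<^esub> g x = g (- x)"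
  using assms by (intro VR.minus_equality) (auto simp: g_0 in_place_ring place_minus)

lemma ideal_place_ideal: "ideal (place_ideal F v) (place_ring F v)"
proof (rule idealI[OF ring_place_ring])
  show "subgroup (place_ideal F v) (add_monoid (place_ring F v))"
  proof (rule group.subgroupI[OF VR.add.is_group])
    show "place_ideal F v \<subseteq> carrier (add_monoid (place_ring F v))"
      by (auto simp: place_ring_def place_ideal_def)
    have "g 0 \<in> place_ideal F v" by (simp add: in_place_ideal)
    then show "place_ideal F v \<noteq> {}" by blast
  next
    fix y assume "y \<in> place_ideal F v"
    then show "inv\<^bsub>add_monoid (place_ring F v)\<^esub> y \<in> place_ideal F v"
      unfolding a_inv_def[symmetric]
      by (elim place_ideal_cases) (auto simp: place_ring_minus in_place_ideal place_minus)
  next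
    fix y z assume "y \<in> place_ideal F v" "z \<in> place_ideal F v"
    then obtain a b where ab: "y = g a" "a = 0 \<or> 0 < v (g a)" "z = g b" "b = 0 \<or> 0 < v (g b)"
      by (meson place_ideal_cases)
    then show "y \<otimes>\<^bsub>add_monoid (place_ring F v)\<^esub> z \<in> place_ideal F v"
      by (simp add: in_place_ideal place_ideal_add)
  qed
next
  fix y z assume "y \<in> place_ideal F v" "z \<in> carrier (place_ring F v)"
  then obtain a b where ab: "y = g a" "a = 0 \<or> 0 < v (g a)" "z = g b" "b = 0 \<or> 0 \<le> v (g b)"
    by (meson place_ideal_cases place_ring_cases)
  then show "z \<otimes>\<^bsub>place_ring F v\<^esub> y \<in> place_ideal F v" "y \<otimes>\<^bsub>place_ring F v\<^esub> z \<in> place_ideal F v"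
    using place_mult[of a b] place_mult[of b a]
    by (cases "a = 0"; cases "b = 0"; auto simp: in_place_ideal)+
qed

interpretation residue: ring_hom_ring "place_ring F v" "residue_field F v"
    "\<lambda>y. place_ideal F v +>\<^bsub>place_ring F v\<^esub> y"
  unfolding residue_field_def by (rule ideal.rcos_ring_hom_ring[OF ideal_place_ideal])

lemma residue_eq_0_iff:
  assumes "x = 0 \<or> 0 \<le> v (g x)"
  shows "place_ideal F v +>\<^bsub>place_ring F v\<^esub> g x = \<zero>\<^bsub>residue_field F v\<^esub> \<longleftrightarrow> x = 0 \<or> 0 < v (g x)"
proof -
  have "\<zero>\<^bsub>residue_field F v\<^esub> = place_ideal F v" by (simp add: residue_field_def FactRing_def)
  moreover have "place_ideal F v +>\<^bsub>place_ring F v\<^esub> g x = place_ideal F v \<longleftrightarrow> g x \<in> place_ideal F v"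
    using assms ideal.rcos_const_imp_mem[OF ideal_place_ideal, of "g x"] VR.a_rcos_zero[OF ideal_place_ideal]
    by (auto simp: in_place_ring)
  ultimately show ?thesis by (simp only: in_place_ideal)
qed

text \<open>Polynomials of degree below \<open>d\<close> represent every residue class exactly once:
  \<open>units\<close> makes the residue map injective on them and \<open>repr\<close> makes it
  onto.\<close>

lemma place_degree_eqI:
  assumes units: "\<And>p. p \<noteq> 0 \<Longrightarrow> Polynomial.degree p < d \<Longrightarrow> v (g (to_fract p)) = 0"
    and repr: "\<And>x. x \<noteq> 0 \<Longrightarrow> 0 \<le> v (g x) \<Longrightarrow>
      \<exists>p \<in> low_degree d. x = to_fract p \<or> 0 < v (g (x - to_fract p))"
  shows "place_degree F constants v = d"
proof -
  define \<pi> where "\<pi> = (\<lambda>x. place_ideal F v +>\<^bsub>place_ring F v\<^esub> g x)"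
  have low: "p = 0 \<or> v (g (to_fract p)) = 0" if "p \<in> low_degree d" for p
    using that units by (auto simp: low_degree_def)
  have const: "c = 0 \<or> v (g (to_fract [:c:])) = 0" for c using place_const by blast
  have one: "\<one>\<^bsub>residue_field F v\<^esub> = \<pi> 1"
    using residue.hom_one by (simp add: \<pi>_def g_1)
  have \<pi>_mult: "\<pi> (x * y) = \<pi> x \<otimes>\<^bsub>residue_field F v\<^esub> \<pi> y" and \<pi>_add: "\<pi> (x + y) = \<pi> x \<oplus>\<^bsub>residue_field F v\<^esub> \<pi> y"
    if "x = 0 \<or> 0 \<le> v (g x)" "y = 0 \<or> 0 \<le> v (g y)" for x y
    using that residue.hom_mult[of "g x" "g y"] residue.hom_add[of "g x" "g y"]
    by (simp_all add: \<pi>_def in_place_ring)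
  have \<pi>_closed: "\<pi> x \<in> carrier (residue_field F v)" if "x = 0 \<or> 0 \<le> v (g x)" for x
    using that residue.hom_closed[of "g x"] by (simp add: \<pi>_def in_place_ring)
  have "ring_hom_ring (ring_of_type_algebra :: 'k ring) (residue_field F v) (\<lambda>c. \<pi> (to_fract [:c:]))"
  proof (rule ring_hom_ringI)
    fix c d :: 'k
    have "to_fract [:c * d:] = to_fract [:c:] * to_fract [:d:]" "to_fract [:c + d:] = to_fract [:c:] + to_fract [:d:]"
      by (simp_all flip: to_fract_mult to_fract_add)
    then show "\<pi> (to_fract [:c \<otimes>\<^bsub>ring_of_type_algebra\<^esub> d:]) = \<pi> (to_fract [:c:]) \<otimes>\<^bsub>residue_field F v\<^esub> \<pi> (to_fract [:d:])"
      "\<pi> (to_fract [:c \<oplus>\<^bsub>ring_of_type_algebra\<^esub> d:]) = \<pi> (to_fract [:c:]) \<oplus>\<^bsub>residue_field F v\<^esub> \<pi> (to_fract [:d:])"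
      using \<pi>_mult[of "to_fract [:c:]" "to_fract [:d:]"] \<pi>_add[of "to_fract [:c:]" "to_fract [:d:]"]
        const[of c] const[of d] by auto
    show "\<pi> (to_fract [:c:]) \<in> carrier (residue_field F v)"
      using const[of c] by (intro \<pi>_closed) auto
  qed (auto simp: one pCons_one intro: ring_from_type_algebra residue.S.ring_axioms)
  then interpret k: ring_hom_ring "ring_of_type_algebra :: 'k ring" "residue_field F v" "\<lambda>c. \<pi> (to_fract [:c:])" .
  have "\<one>\<^bsub>residue_field F v\<^esub> \<noteq> \<zero>\<^bsub>residue_field F v\<^esub>"
    using residue_eq_0_iff[of 1] by (simp add: one \<pi>_def place_1)
  \<comment> \<open>As 1 and 0 differ in the residue ring, the field of constants embeds, and its
    image is a subfield over which dimensions are unique.\<close>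
  moreover have "subfield (carrier ring_of_type_algebra) (ring_of_type_algebra :: 'k ring)"
    by (rule field.carrier_is_subfield) (rule field_from_type_algebra)
  ultimately have subfield: "subfield (range (\<lambda>c. \<pi> (to_fract [:c:]))) (residue_field F v)"
    using k.img_is_subfield(2) by simp
  have dim: "residue.S.dimension d (range (\<lambda>c. \<pi> (to_fract [:c:]))) ((\<lambda>p. \<pi> (to_fract p)) ` low_degree d)"
  proof (rule residue.S.dimension_low_degree[where d = d])
    fix p :: "'k poly" assume p: "p \<in> low_degree d"
    show "\<pi> (to_fract p) \<in> carrier (residue_field F v)" using low[OF p] by (intro \<pi>_closed) auto
    show "p = 0" if "\<pi> (to_fract p) = \<zero>\<^bsub>residue_field F v\<^esub>"
      using low[OF p] that residue_eq_0_iff[of "to_fract p"] by (auto simp: \<pi>_def)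
    show "\<pi> (to_fract (p + q)) = \<pi> (to_fract p) \<oplus>\<^bsub>residue_field F v\<^esub> \<pi> (to_fract q)"
      if "q \<in> low_degree d" for q
      using low[OF p] low[OF that] \<pi>_add[of "to_fract p" "to_fract q"] by auto
    show "\<pi> (to_fract (smult c p)) = \<pi> (to_fract [:c:]) \<otimes>\<^bsub>residue_field F v\<^esub> \<pi> (to_fract p)" for c
    proof -
      have "to_fract (smult c p) = to_fract [:c:] * to_fract p" by (simp flip: to_fract_mult)
      then show ?thesis using \<pi>_mult[of "to_fract [:c:]" "to_fract p"] low[OF p] const[of c] by auto
    qed
  qed simp
  have "carrier (residue_field F v) = (\<lambda>p. \<pi> (to_fract p)) ` low_degree d"
  proof (intro equalityI subsetI)
    fix y assume "y \<in> carrier (residue_field F v)"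
    then obtain z where "y = place_ideal F v +>\<^bsub>place_ring F v\<^esub> z" "z \<in> carrier (place_ring F v)"
      by (auto simp: residue_field_def FactRing_def A_RCOSETS_def')
    then obtain x where y: "y = \<pi> x" and x: "x = 0 \<or> 0 \<le> v (g x)"
      by (auto simp: \<pi>_def elim!: place_ring_cases)
    have "\<exists>p \<in> low_degree d. x = to_fract p \<or> 0 < v (g (x - to_fract p))"
    proof (cases "x = 0")
      case True
      then show ?thesis using low_degree_closed(4)[of d] by (intro bexI[of _ 0]) auto
    next
      case False
      then show ?thesis using x by (intro repr) auto
    qed
    then obtain p where p: "p \<in> low_degree d" "x = to_fract p \<or> 0 < v (g (x - to_fract p))" by blast
    define r where "r = x - to_fract p"
    have r: "r = 0 \<or> 0 < v (g r)" using p by (auto simp: r_def)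
    then have "\<pi> r = \<zero>\<^bsub>residue_field F v\<^esub>" using residue_eq_0_iff[of r] by (auto simp: \<pi>_def)
    moreover have "\<pi> (r + to_fract p) = \<pi> r \<oplus>\<^bsub>residue_field F v\<^esub> \<pi> (to_fract p)"
      using r low[OF p(1)] by (intro \<pi>_add) auto
    moreover have "\<pi> (to_fract p) \<in> carrier (residue_field F v)" using low[OF p(1)] by (intro \<pi>_closed) auto
    ultimately have "y = \<pi> (to_fract p)" by (simp add: y r_def)
    then show "y \<in> (\<lambda>p. \<pi> (to_fract p)) ` low_degree d" using p by blast
  next
    fix y assume "y \<in> (\<lambda>p. \<pi> (to_fract p)) ` low_degree d"
    then obtain p where "y = \<pi> (to_fract p)" "p \<in> low_degree d" by blast
    then show "y \<in> carrier (residue_field F v)" using low[of p] \<pi>_closed[of "to_fract p"] by auto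
  qed
  moreover have "(\<lambda>c. place_ideal F v +>\<^bsub>place_ring F v\<^esub> c) ` constants = range (\<lambda>c. \<pi> (to_fract [:c:]))"
    by (simp add: constants_def \<pi>_def image_image)
  ultimately show ?thesis
    using residue.S.dimI[OF subfield dim] by (simp add: place_degree_def over_def)
qed

end

lemma place_degree_vprime:
  assumes P: "Factorial_Ring.prime P"
  shows "place_degree F constants (vprime P) = Polynomial.degree P"
proof (rule place_degree_eqI)
  have ne: "P \<noteq> 0" "\<not> is_unit P" using P by (auto simp: Factorial_Ring.prime_def prime_elem_def)
  show "vprime P \<in> places F constants" using P by (simp add: places_eq)
  show "vprime P (g (to_fract p)) = 0" if "p \<noteq> 0" "Polynomial.degree p < Polynomial.degree P" for p
  proof -
    have "\<not> P dvd p" using that dvd_imp_degree_le[of P p] by auto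
    then show ?thesis using vprime_quotient[OF P that(1), of 1] by (simp add: not_dvd_imp_multiplicity_0)
  qed
  fix x :: "'k poly fract" assume x: "x \<noteq> 0" "0 \<le> vprime P (g x)"
  obtain a b where ab: "x = to_fract a / to_fract b" "b \<noteq> 0" "coprime a b"
  proof -
    obtain a b where ab: "quot_of_fract x = (a, b)" by fastforce
    then have "x = to_fract a / to_fract b"
      using quot_to_fract_quot_of_fract[of x] by (simp add: quot_to_fract_def Fract_conv_to_fract)
    moreover have "b \<noteq> 0" "coprime a b"
      using ab snd_quot_of_fract_nonzero[of x] coprime_quot_of_fract[of x] by simp_all
    ultimately show thesis by (rule that)
  qed
  have a: "a \<noteq> 0" using ab x by auto
  have "\<not> P dvd b"
  proof
    assume dvd: "P dvd b"
    then have "1 \<le> multiplicity P b" using ne ab by (intro multiplicity_geI) auto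
    moreover have "multiplicity P b \<le> multiplicity P a" using x vprime_quotient[OF P a ab(2)] ab(1) by simp
    ultimately have "P dvd a" using not_dvd_imp_multiplicity_0[of P a] by (cases "P dvd a") auto
    with dvd ab(3) ne show False using not_coprimeI by blast
  qed
  then have "coprime P b" using P by (simp add: prime_imp_coprime)
  \<comment> \<open>\<open>t\<close> inverts the denominator \<open>b\<close> modulo
    \<open>P\<close>, so the residue class of \<open>a / b\<close> is represented by the remainder
    of \<open>a * t\<close>.\<close>
  then obtain s t where st: "s * P + t * b = 1" by (metis bezout_coefficients_fst_snd coprime_imp_gcd_eq_1)
  define p where "p = (a * t) mod P"
  have "p \<in> low_degree (Polynomial.degree P)"
    using degree_mod_less[OF ne(1), of "a * t"] by (auto simp: p_def low_degree_def)
  moreover have "x = to_fract p \<or> 0 < vprime P (g (x - to_fract p))"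
  proof (cases "x = to_fract p")
    case False
    have eq: "x - to_fract p = to_fract (a - b * p) / to_fract b" using ab by (simp add: field_simps)
    then have ne': "a - b * p \<noteq> 0" using False by auto
    have "a - b * p = a * (s * P + t * b) - b * p" by (simp add: st)
    also have "\<dots> = P * (a * s) + b * (a * t - p)" by (simp add: algebra_simps)
    also have "a * t - p = P * (a * t div P)" by (simp add: p_def minus_mod_eq_mult_div)
    finally have "P dvd a - b * p" by (metis dvd_add dvd_triv_left dvd_mult mult.left_commute)
    then have "1 \<le> multiplicity P (a - b * p)" using ne ne' by (intro multiplicity_geI) auto
    moreover have "multiplicity P b = 0" using \<open>\<not> P dvd b\<close> by (rule not_dvd_imp_multiplicity_0)
    ultimately show ?thesis unfolding eq using vprime_quotient[OF P ne' ab(2)] by simp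
  qed simp
  ultimately show "\<exists>p \<in> low_degree (Polynomial.degree P). x = to_fract p \<or> 0 < vprime P (g (x - to_fract p))"
    by blast
qed

lemma place_degree_vinf: "place_degree F constants vinf = 1"
proof (rule place_degree_eqI)
  show "vinf \<in> places F constants" by (simp add: places_eq)
  show "vinf (g (to_fract p)) = 0" if "p \<noteq> 0" "Polynomial.degree p < 1" for p
    using vinf_quotient[of p 1] that by simp
  fix x :: "'k poly fract" assume x: "x \<noteq> 0" "0 \<le> vinf (g x)"
  obtain a b where ab: "x = to_fract a / to_fract b" "b \<noteq> 0" by (rule Fract_cases_to_fract)
  then have a: "a \<noteq> 0" using x by auto
  have le: "Polynomial.degree a \<le> Polynomial.degree b" using x vinf_quotient[OF a ab(2)] ab(1) by simp
  \<comment> \<open>The value of \<open>a / b\<close> at infinity. The coefficient of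
    \<open>a\<close> is taken at the degree of \<open>b\<close>, so that \<open>c\<close> is 0 when
    \<open>a\<close> has the smaller degree.\<close>
  define c where "c = Polynomial.coeff a (Polynomial.degree b) / Polynomial.lead_coeff b"
  have "[:c:] \<in> low_degree 1" by (simp add: low_degree_def)
  moreover have "x = to_fract [:c:] \<or> 0 < vinf (g (x - to_fract [:c:]))"
  proof (cases "x = to_fract [:c:]")
    case False
    have "x - to_fract [:c:] = to_fract (a - b * [:c:]) / to_fract b" using ab by (simp add: field_simps flip: to_fract_mult)
    then have eq: "x - to_fract [:c:] = to_fract (a - smult c b) / to_fract b" by simp
    then have ne: "a - smult c b \<noteq> 0" using False by auto
    have "Polynomial.coeff (a - smult c b) i = 0" if "Polynomial.degree b \<le> i" for i
      using that le ab by (cases "i = Polynomial.degree b") (auto simp: c_def coeff_eq_0)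
    then have "a - smult c b \<in> low_degree (Polynomial.degree b)" by (simp add: low_degree_iff)
    then have "Polynomial.degree (a - smult c b) < Polynomial.degree b" using ne by (simp add: low_degree_def)
    then show ?thesis unfolding eq using vinf_quotient[OF ne ab(2)] by simp
  qed simp
  ultimately show "\<exists>p \<in> low_degree 1. x = to_fract p \<or> 0 < vinf (g (x - to_fract p))" by blast
qed

section \<open>Divisors and their Riemann-Roch spaces\<close>

lemma
  assumes D: "D \<in> divisors F constants"
  defines "S \<equiv> {P. Factorial_Ring.prime P \<and> D (vprime P) \<noteq> 0}"
  shows finite_prime_support: "finite S"
    and divisor_degree_eq: "divisor_degree F constants D =
      D vinf + (\<Sum>P\<in>S. D (vprime P) * int (Polynomial.degree P))"
proof -
  let ?V = "{v \<in> places F constants. D v \<noteq> 0}" and ?W = "{v. v = vinf \<and> D v \<noteq> 0}"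
  have V: "?V = vprime ` S \<union> ?W" by (auto simp: places_eq S_def)
  have inj: "inj_on vprime S" using inj_vprime by (rule inj_on_subset) (auto simp: S_def)
  have "finite ?V" using D by (simp add: divisors_def)
  then have "finite (vprime ` S)" unfolding V by simp
  then show S: "finite S" using inj by (simp add: finite_image_iff)
  have W: "?W = (if D vinf = 0 then {} else {vinf})" by auto
  have "vprime ` S \<inter> ?W = {}" using vinf_not_vprime by (auto simp: S_def) metis
  then have "divisor_degree F constants D =
      (\<Sum>v \<in> vprime ` S. D v * int (place_degree F constants v)) + (\<Sum>v \<in> ?W. D v * int (place_degree F constants v))"
    unfolding divisor_degree_def V using S by (intro sum.union_disjoint) (auto simp: W)
  also have "(\<Sum>v \<in> ?W. D v * int (place_degree F constants v)) = D vinf"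
    by (simp add: W place_degree_vinf)
  also have "(\<Sum>v \<in> vprime ` S. D v * int (place_degree F constants v)) =
      (\<Sum>P\<in>S. D (vprime P) * int (place_degree F constants (vprime P)))"
    using inj by (simp add: sum.reindex)
  also have "\<dots> = (\<Sum>P\<in>S. D (vprime P) * int (Polynomial.degree P))"
    by (intro sum.cong refl) (simp add: S_def place_degree_vprime)
  finally show "divisor_degree F constants D =
      D vinf + (\<Sum>P\<in>S. D (vprime P) * int (Polynomial.degree P))" by simp
qed

text \<open>The finite part of a divisor is principal, say of \<open>A / B\<close>, so the Riemann--Roch space consists
  of the multiples of \<open>B / A\<close> by polynomials of bounded degree.\<close>

lemma riemann_roch_space_eq:
  assumes D: "D \<in> divisors F constants"
  obtains x where "x \<noteq> 0" "riemann_roch_space F constants D =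
    (\<lambda>p. g (to_fract p * x)) ` low_degree (nat (divisor_degree F constants D + 1))"
proof -
  define S where "S = {P. Factorial_Ring.prime P \<and> D (vprime P) \<noteq> 0}"
  \<comment> \<open>Truncation by \<open>nat\<close> collects the positive coefficients of
    \<open>D\<close> in \<open>A\<close> and the negative ones in \<open>B\<close>, so
    \<open>A / B\<close> has order \<open>D (vprime P)\<close> at every prime
    \<open>P\<close>.\<close>
  define A where "A = (\<Prod>P\<in>S. P ^ nat (D (vprime P)))"
  define B where "B = (\<Prod>P\<in>S. P ^ nat (- D (vprime P)))"
  define N where "N = divisor_degree F constants D"
  have S: "finite S" "\<And>P. P \<in> S \<Longrightarrow> Factorial_Ring.prime P"
    using finite_prime_support[OF D] by (auto simp: S_def)
  have S0: "P \<noteq> 0" if "P \<in> S" for P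
    using S(2)[OF that] by auto
  have AB: "A \<noteq> 0" "B \<noteq> 0" using S(1) S0 by (auto simp: A_def B_def)
  have mult: "int (multiplicity P A) - int (multiplicity P B) = D (vprime P)" if "Factorial_Ring.prime P" for P
  proof -
    have "multiplicity P A = (if P \<in> S then nat (D (vprime P)) else 0)"
      "multiplicity P B = (if P \<in> S then nat (- D (vprime P)) else 0)"
      unfolding A_def B_def
      using multiplicity_prod_prime_powers[OF S that, of "\<lambda>P. nat (D (vprime P))"]
        multiplicity_prod_prime_powers[OF S that, of "\<lambda>P. nat (- D (vprime P))"] by auto
    moreover have "D (vprime P) = 0" if "P \<notin> S" using that \<open>Factorial_Ring.prime P\<close> by (simp add: S_def)
    ultimately show ?thesis by (cases "P \<in> S") simp_all
  qed
  have "int (Polynomial.degree (\<Prod>P\<in>S. P ^ f P)) = (\<Sum>P\<in>S. int (f P) * int (Polynomial.degree P))" for f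
    using S0 by (subst degree_prod_eq_sum_degree) (auto simp: degree_power_eq)
  then have "int (Polynomial.degree A) - int (Polynomial.degree B) =
      (\<Sum>P\<in>S. int (nat (D (vprime P))) * int (Polynomial.degree P) - int (nat (- D (vprime P))) * int (Polynomial.degree P))"
    by (simp add: A_def B_def sum_subtractf)
  also have "\<dots> = (\<Sum>P\<in>S. D (vprime P) * int (Polynomial.degree P))"
  proof (intro sum.cong refl)
    show "int (nat d) * k - int (nat (- d)) * k = d * k" for d k :: int
      by (cases "0 \<le> d") simp_all
  qed
  finally have N: "N = D vinf + int (Polynomial.degree A) - int (Polynomial.degree B)"
    using divisor_degree_eq[OF D] by (simp add: N_def S_def)
  define x where "x = to_fract B / to_fract A"
  have "riemann_roch_space F constants D = (\<lambda>p. g (to_fract p * x)) ` low_degree (nat (N + 1))"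
  proof (intro equalityI subsetI)
    fix y assume y: "y \<in> riemann_roch_space F constants D"
    then have "y \<in> carrier F" by (simp add: riemann_roch_space_def)
    then obtain z where z: "y = g z" by (rule carrier_cases)
    show "y \<in> (\<lambda>p. g (to_fract p * x)) ` low_degree (nat (N + 1))"
    proof (cases "z = 0")
      case True
      then show ?thesis using low_degree_closed(4) by (intro image_eqI[of _ _ 0]) (auto simp: z)
    next
      case False
      obtain p q where pq: "z = to_fract p / to_fract q" "q \<noteq> 0" by (rule Fract_cases_to_fract)
      then have p: "p \<noteq> 0" using False by auto
      have ge: "- D v \<le> v (g z)" if "v \<in> places F constants" for v
        using y that False by (simp add: riemann_roch_space_def z)
      \<comment> \<open>The conditions at the primes say that \<open>z * A / B\<close> has no finite
        poles, so it is a polynomial \<open>r\<close>.\<close>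
      have "q * B dvd p * A"
      proof (rule multiplicity_le_imp_dvd)
        show "q * B \<noteq> 0" using pq AB by simp
        fix P :: "'k poly" assume P: "Factorial_Ring.prime P"
        then have "prime_elem P" by simp
        moreover have "- D (vprime P) \<le> int (multiplicity P p) - int (multiplicity P q)"
          using ge[of "vprime P"] P vprime_quotient[OF P p pq(2)] by (simp add: places_eq pq(1))
        ultimately show "multiplicity P (q * B) \<le> multiplicity P (p * A)"
          using mult[OF P] p pq(2) AB by (simp add: prime_elem_multiplicity_mult_distrib)
      qed
      then obtain r where r: "p * A = q * B * r" by blast
      then have r0: "r \<noteq> 0" using p AB by auto
      have "to_fract p * to_fract A = to_fract q * to_fract B * to_fract r"
        by (simp add: r flip: to_fract_mult)
      then have "z = to_fract r * x"
        unfolding pq(1) x_def using pq(2) AB by (simp add: frac_eq_eq ac_simps)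
      moreover have "r \<in> low_degree (nat (N + 1))"
      proof -
        \<comment> \<open>The remaining condition, at infinity, bounds the degree of
          \<open>r\<close> by \<open>N\<close>.\<close>
        have "Polynomial.degree (p * A) = Polynomial.degree (q * B * r)" by (simp only: r)
        then have "Polynomial.degree p + Polynomial.degree A = Polynomial.degree q + Polynomial.degree B + Polynomial.degree r"
          using p pq(2) AB r0 by (simp add: degree_mult_eq)
        moreover have "- D vinf \<le> int (Polynomial.degree q) - int (Polynomial.degree p)"
          using ge[of vinf] vinf_quotient[OF p pq(2)] by (simp add: places_eq pq(1))
        ultimately have "int (Polynomial.degree r) \<le> N" using N by linarith
        then have "Polynomial.degree r < nat (N + 1)" by linarith
        then show ?thesis by (simp add: low_degree_def)
      qed
      ultimately show ?thesis by (auto simp: z)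
    qed
  next
    fix y assume "y \<in> (\<lambda>p. g (to_fract p * x)) ` low_degree (nat (N + 1))"
    then obtain r where y: "y = g (to_fract r * x)" and r: "r \<in> low_degree (nat (N + 1))" by blast
    show "y \<in> riemann_roch_space F constants D"
    proof (cases "r = 0")
      case True
      then show ?thesis by (simp add: y riemann_roch_space_def)
    next
      case False
      have eq: "to_fract r * x = to_fract (r * B) / to_fract A" by (simp add: x_def)
      have rB: "r * B \<noteq> 0" using False AB by simp
      have "- D (vprime P) \<le> vprime P y" if P: "Factorial_Ring.prime P" for P
      proof -
        have "prime_elem P" using P by simp
        then show ?thesis
          using mult[OF P] False AB
          by (simp only: y eq vprime_quotient[OF P rB AB(1)]) (simp add: prime_elem_multiplicity_mult_distrib)
      qed
      moreover have "- D vinf \<le> vinf y"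
      proof -
        have "int (Polynomial.degree r) \<le> N" using r False unfolding low_degree_def by simp
        then show ?thesis
          using N False AB by (simp only: y eq vinf_quotient[OF rB AB(1)]) (simp add: degree_mult_eq)
      qed
      moreover have "y \<in> carrier F" by (simp add: y)
      ultimately show ?thesis by (auto simp: riemann_roch_space_def places_eq)
    qed
  qed
  moreover have "x \<noteq> 0" using AB by (simp add: x_def)
  ultimately show thesis using that by (simp add: N_def)
qed

lemma dim_riemann_roch_space:
  assumes D: "D \<in> divisors F constants"
  shows "ring.dim F constants (riemann_roch_space F constants D) = nat (divisor_degree F constants D + 1)"
proof -
  let ?n = "nat (divisor_degree F constants D + 1)"
  obtain x where x: "x \<noteq> 0" "riemann_roch_space F constants D = (\<lambda>p. g (to_fract p * x)) ` low_degree ?n"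
    using riemann_roch_space_eq[OF D] by blast
  have "F.S.dimension ?n (range (\<lambda>c. g (to_fract [:c:]))) ((\<lambda>p. g (to_fract p * x)) ` low_degree ?n)"
  proof (rule F.S.dimension_low_degree[where d = ?n])
    fix p :: "'k poly" and c :: 'k
    have "to_fract (smult c p) = to_fract [:c:] * to_fract p" by (simp flip: to_fract_mult)
    then show "g (to_fract (smult c p) * x) = g (to_fract [:c:]) \<otimes> g (to_fract p * x)"
      by (simp add: mult.assoc)
    show "p = 0" if "g (to_fract p * x) = \<zero>" using that x(1) by simp
  qed (simp_all add: distrib_right)
  note this[folded constants_def, folded x(2)]
  then show ?thesis
    using F.S.dimI[OF subfield_constants] by (simp add: over_def)
qed

text \<open>Since \<open>l(D)\<close> is \<open>nat (deg D + 1)\<close>, the quantity to be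
  maximized equals the minimum of 0 and \<open>deg D + 1\<close>.\<close>

lemma genus_0: "function_field_has_genus F constants 0"
proof -
  have zero: "(\<lambda>_. 0) \<in> divisors F constants" by (simp add: divisors_def)
  have "divisor_degree F constants (\<lambda>_. 0) = 0" by (simp add: divisor_degree_def)
  then have "\<exists>D \<in> divisors F constants. divisor_degree F constants D
      - int (ring.dim F constants (riemann_roch_space F constants D)) + 1 = int 0"
    using dim_riemann_roch_space[OF zero] zero by (intro bexI[of _ "\<lambda>_. 0"]) simp_all
  then show ?thesis
    unfolding function_field_has_genus_def by (simp add: dim_riemann_roch_space)
qed

end

lemma linear_curve_rational_genus_0:
  assumes "u \<noteq> 0" "coprime w u"
  shows "rational_curve [:w, u:] \<and> has_genus [:w, u:] 0"
proof -
  let ?f = "[:w, u:]" and ?F = "curve_function_field [:w, u:]"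
  obtain h where h: "h \<in> ring_iso ?F (ring_of_type_algebra :: rat poly fract ring)"
    and const: "\<And>c. h (curve_const ?f c) = Fract [:c:] 1"
    using curve_function_field_iso(3)[OF assms] by blast
  note ring = curve_function_field_iso(1)[OF assms]
  \<comment> \<open>The locale expects the isomorphism to start at the rational functions, hence the
    inverse; because \<open>h\<close> respects constants, the two descriptions of the constant field
    agree.\<close>
  let ?g = "inv_into (carrier ?F) h"
  interpret rational_function_field ?F ?g
    by (intro rational_function_field.intro ring ring_iso_set_sym[OF ring h])
  have "inj_on h (carrier ?F)" using h by (simp add: ring_iso_def bij_betw_def)
  then have "?g (to_fract [:c:]) = curve_const ?f c" for c
    using inv_into_f_f[of h "carrier ?F" "curve_const ?f c"] curve_function_field_iso(2)[OF assms]
    by (simp add: const to_fract_def)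
  then have "constants = range (curve_const ?f)" by (simp add: constants_def)
  then show ?thesis
    using genus_0 rational_linear_curve[OF assms] irreducible_linear_curve[OF assms]
    by (simp add: has_genus_def)
qed

section \<open>The three curves and the conclusion\<close>

lemma coprime_if_unit_diff: "is_unit (p - q) \<Longrightarrow> coprime p q" for p q :: "'a :: {comm_ring_1, algebraic_semidom}"
  by (rule coprimeI) (meson dvd_diff dvd_trans)

lemma rational_curves_genus_0:
  "rational_curve curve_Xa \<and> has_genus curve_Xa 0"
  "rational_curve curve_Xb \<and> has_genus curve_Xb 0"
  "rational_curve curve_Xc \<and> has_genus curve_Xc 0"
proof -
  have eq: "curve_Xa = [:[:-1, -1:], [:1, -1:]:]" "curve_Xb = [:[:1, 1:], [:-1, 1:]:]"
    "curve_Xc = [:[:-1, 1:], [:1, 1:]:]"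
    by (simp_all add: curve_Xa_def curve_Xb_def curve_Xc_def one_pCons)
  \<comment> \<open>The two coefficients of each curve differ by the constant 2 or -2, a unit over
    the rationals, which makes them coprime.\<close>
  have "is_unit ([:-1, -1:] - [:1, -1 :: rat:])" "is_unit ([:1, 1:] - [:-1, 1 :: rat:])"
    "is_unit ([:-1, 1:] - [:1, 1 :: rat:])"
    by (simp_all add: is_unit_const_poly_iff dvd_field_iff)
  then have cop: "coprime [:-1, -1:] [:1, -1 :: rat:]" "coprime [:1, 1:] [:-1, 1 :: rat:]"
    "coprime [:-1, 1:] [:1, 1 :: rat:]"
    by (simp_all only: coprime_if_unit_diff)
  show "rational_curve curve_Xa \<and> has_genus curve_Xa 0"
    unfolding eq by (rule linear_curve_rational_genus_0[OF _ cop(1)]) simp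
  show "rational_curve curve_Xb \<and> has_genus curve_Xb 0"
    unfolding eq by (rule linear_curve_rational_genus_0[OF _ cop(2)]) simp
  show "rational_curve curve_Xc \<and> has_genus curve_Xc 0"
    unfolding eq by (rule linear_curve_rational_genus_0[OF _ cop(3)]) simp
qed

theorem theorem5p2:
  shows "(\<forall>A B C a b c. rational_right_triangle A B C a b c \<longrightarrow>
      (is_exradius A B C 1 \<longrightarrow>
         (\<exists>x z. (x, z) \<in> rational_points curve_Xa \<and> (a, b, c) = (x + 1, z - 1, z - x))) \<and>
      (is_exradius B C A 1 \<longrightarrow>
         (\<exists>x z. (x, z) \<in> rational_points curve_Xb \<and> (a, b, c) = (z - 1, x + 1, z - x))) \<and>
      (is_exradius C A B 1 \<longrightarrow>
         (\<exists>x y. (x, y) \<in> rational_points curve_Xc \<and> (a, b, c) = (1 - y, 1 - x, x + y)))) \<and>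
    (rational_curve curve_Xa \<and> has_genus curve_Xa 0) \<and>
    (rational_curve curve_Xb \<and> has_genus curve_Xb 0) \<and>
    (rational_curve curve_Xc \<and> has_genus curve_Xc 0) \<and>
    infinite {(a, b, c). \<exists>A B C. rational_right_triangle A B C a b c \<and> is_exradius A B C 1} \<and>
    infinite {(a, b, c). \<exists>A B C. rational_right_triangle A B C a b c \<and> is_exradius B C A 1} \<and>
    infinite {(a, b, c). \<exists>A B C. rational_right_triangle A B C a b c \<and> is_exradius C A B 1}"
  by (intro conjI allI impI)
    (assumption | rule exradius_points rational_curves_genus_0[THEN conjunct1]
      rational_curves_genus_0[THEN conjunct2] infinite_exradius_leg infinite_exradius_other_leg
      infinite_exradius_hypotenuse)+

end
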